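(* Let $G$ be an ample Hausdorff groupoid, and let $R$ be a commutative ring with identity. Then $G$ is strongly effective if and only if $$U \mapsto I_U:=\{f \in A_R(G) : \operatorname{supp} f \subseteq G_U\}$$ is a lattice isomorphism from the open invariant subsets of $G^{(0)}$ onto the basic ideals of $A_R(G)$.
   Context: Groupoids. $G$ is a topological groupoid with unit space $G^{(0)}$ and range and source maps $r,s:G\to G^{(0)}$. An open bisection is an open set $B\subseteq G$ such that $r$ and $s$ restrict to homeomorphisms of $B$ onto open subsets of $G^{(0)}$. $G$ is ample if it has a basis of compact open bisections. The isotropy is $\operatorname{Iso}(G)=\{\gamma\in G: r(\gamma)=s(\gamma)\}$. An ample Hausdorff groupoid is effective if the interior of $\operatorname{Iso}(G)$ in $G$ equals $G^{(0)}$. A subset $U\subseteq G^{(0)}$ is invariant if $s(\gamma)\in U$ implies $r(\gamma)\in U$ for all $\gamma \in G$; then $G_U:=s^{-1}(U)=\{\gamma: r(\gamma),s(\gamma)\in U\}$ is a groupoid with unit space $U$ (subspace topology). $G$ is strongly effective if $G_V$ is effective for every nonempty closed invariant $V\subseteq G^{(0)}$. Steinberg algebra. $A_R(G)$ is the $R$-algebra of all locally constant, compactly supported functions $f:G\to R$ with pointwise addition and convolution $(f*g)(\gamma)=\sum_{\beta: r(\beta)=r(\gamma)} f(\beta)g(\beta^{-1}\gamma)$. The support $\operatorname{supp} f=\{\gamma: f(\gamma)\ne 0\}$ is compact and open. $1_B$ denotes the characteristic function of $B$. Ideals are two-sided. Basic ideals. An ideal $I$ of $A_R(G)$ is basic if,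 whenever $K\subseteq G^{(0)}$ is compact open, $0\ne r\in R$ and $r1_K\in I$, then $1_K\in I$. Lattices. Open invariant subsets of $G^{(0)}$ (including $\emptyset$) are ordered by inclusion, with operations $\cup$ and $\cap$; ideals are ordered by inclusion with operations $+$ and $\cap$. A lattice isomorphism onto the basic ideals is a bijection onto the set of basic ideals that carries $\cup$ to $+$ and $\cap$ to $\cap$. *)

theory Defs
  imports "HOL-Analysis.Analysis"
begin

text \<open>
  The carrier of a groupoid is the \<^const>\<open>topspace\<close> of an abstract topology, and its objects are
  identified with their unit arrows, so that the unit space is a subset of the carrier. The
  operations are total functions; their values outside the carrier, and those of the
  multiplication on non-composable pairs, are irrelevant.
\<close>

record 'g tgroupoid =
  gtop :: "'g topology"
  rmap :: "'g \<Rightarrow> 'g"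
  smap :: "'g \<Rightarrow> 'g"
  gmult :: "'g \<Rightarrow> 'g \<Rightarrow> 'g"
  ginv :: "'g \<Rightarrow> 'g"

abbreviation arrows :: "'g tgroupoid \<Rightarrow> 'g set" where
  "arrows G \<equiv> topspace (gtop G)"

definition units :: "'g tgroupoid \<Rightarrow> 'g set" where
  "units G = rmap G ` arrows G"

definition composable :: "'g tgroupoid \<Rightarrow> ('g \<times> 'g) set" where
  "composable G = {(x, y). x \<in> arrows G \<and> y \<in> arrows G \<and> smap G x = rmap G y}"

locale algebraic_groupoid =
  fixes G :: "'g tgroupoid"
  assumes r_closed: "x \<in> arrows G \<Longrightarrow> rmap G x \<in> arrows G"
    and s_closed: "x \<in> arrows G \<Longrightarrow> smap G x \<in> arrows G"
    and r_r: "x \<in> arrows G \<Longrightarrow> rmap G (rmap G x) = rmap G x"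
    and s_r: "x \<in> arrows G \<Longrightarrow> smap G (rmap G x) = rmap G x"
    and r_s: "x \<in> arrows G \<Longrightarrow> rmap G (smap G x) = smap G x"
    and s_s: "x \<in> arrows G \<Longrightarrow> smap G (smap G x) = smap G x"
    and mult_closed: "(x, y) \<in> composable G \<Longrightarrow> gmult G x y \<in> arrows G"
    and r_mult: "(x, y) \<in> composable G \<Longrightarrow> rmap G (gmult G x y) = rmap G x"
    and s_mult: "(x, y) \<in> composable G \<Longrightarrow> smap G (gmult G x y) = smap G y"
    and mult_assoc: "\<lbrakk>(x, y) \<in> composable G; (y, z) \<in> composable G\<rbrakk>
          \<Longrightarrow> gmult G (gmult G x y) z = gmult G x (gmult G y z)"
    and left_unit: "x \<in> arrows G \<Longrightarrow> gmult G (rmap G x) x = x"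
    and right_unit: "x \<in> arrows G \<Longrightarrow> gmult G x (smap G x) = x"
    and inv_closed: "x \<in> arrows G \<Longrightarrow> ginv G x \<in> arrows G"
    and r_inv: "x \<in> arrows G \<Longrightarrow> rmap G (ginv G x) = smap G x"
    and s_inv: "x \<in> arrows G \<Longrightarrow> smap G (ginv G x) = rmap G x"
    and left_inv: "x \<in> arrows G \<Longrightarrow> gmult G (ginv G x) x = smap G x"
    and right_inv: "x \<in> arrows G \<Longrightarrow> gmult G x (ginv G x) = rmap G x"

text \<open>Continuity of range and source follows, since they are \<open>x x\<inverse>\<close> and \<open>x\<inverse> x\<close>.\<close>

locale topological_groupoid = algebraic_groupoid +
  assumes continuous_mult:
      "continuous_map (subtopology (prod_topology (gtop G) (gtop G)) (composable G)) (gtop G)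
         (\<lambda>(x, y). gmult G x y)"
    and continuous_inv: "continuous_map (gtop G) (gtop G) (ginv G)"

definition unit_top :: "'g tgroupoid \<Rightarrow> 'g topology" where
  "unit_top G = subtopology (gtop G) (units G)"

definition open_bisection :: "'g tgroupoid \<Rightarrow> 'g set \<Rightarrow> bool" where
  "open_bisection G B \<longleftrightarrow> openin (gtop G) B
     \<and> openin (unit_top G) (rmap G ` B)
     \<and> homeomorphic_map (subtopology (gtop G) B) (subtopology (unit_top G) (rmap G ` B)) (rmap G)
     \<and> openin (unit_top G) (smap G ` B)
     \<and> homeomorphic_map (subtopology (gtop G) B) (subtopology (unit_top G) (smap G ` B)) (smap G)"

locale ample_groupoid = topological_groupoid +
  assumes ample_basis: "\<lbrakk>openin (gtop G) W; x \<in> W\<rbrakk>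
    \<Longrightarrow> \<exists>B. open_bisection G B \<and> compactin (gtop G) B \<and> x \<in> B \<and> B \<subseteq> W"

definition Iso :: "'g tgroupoid \<Rightarrow> 'g set" where
  "Iso G = {x \<in> arrows G. rmap G x = smap G x}"

definition effective :: "'g tgroupoid \<Rightarrow> bool" where
  "effective G \<longleftrightarrow> gtop G interior_of Iso G = units G"

definition invariant :: "'g tgroupoid \<Rightarrow> 'g set \<Rightarrow> bool" where
  "invariant G U \<longleftrightarrow> U \<subseteq> units G \<and> (\<forall>x \<in> arrows G. smap G x \<in> U \<longrightarrow> rmap G x \<in> U)"

definition reduction_arrows :: "'g tgroupoid \<Rightarrow> 'g set \<Rightarrow> 'g set" where
  "reduction_arrows G U = {x \<in> arrows G. smap G x \<in> U}"

definition reduction :: "'g tgroupoid \<Rightarrow> 'g set \<Rightarrow> 'g tgroupoid" where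
  "reduction G U = G\<lparr>gtop := subtopology (gtop G) (reduction_arrows G U)\<rparr>"

definition strongly_effective :: "'g tgroupoid \<Rightarrow> bool" where
  "strongly_effective G \<longleftrightarrow>
     (\<forall>V. V \<noteq> {} \<and> closedin (unit_top G) V \<and> invariant G V \<longrightarrow> effective (reduction G V))"

definition supp :: "('g \<Rightarrow> 'r::zero) \<Rightarrow> 'g set" where
  "supp f = {x. f x \<noteq> 0}"

definition locally_constant :: "'g topology \<Rightarrow> ('g \<Rightarrow> 'r) \<Rightarrow> bool" where
  "locally_constant T f \<longleftrightarrow>
     (\<forall>x \<in> topspace T. \<exists>W. openin T W \<and> x \<in> W \<and> (\<forall>y \<in> W. f y = f x))"

text \<open>
  Functions on the groupoid are represented by functions on the whole type that vanish off the
  carrier; this is enforced by \<open>compactin (gtop G) (supp f)\<close>, which includes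
  \<open>supp f \<subseteq> arrows G\<close>. For a locally constant function \<open>supp f\<close> is closed in the groupoid, so it is
  the support in the topological sense too.
\<close>

definition steinberg :: "'g tgroupoid \<Rightarrow> ('g \<Rightarrow> 'r::comm_ring_1) set" where
  "steinberg G = {f. locally_constant (gtop G) f \<and> compactin (gtop G) (supp f)}"

text \<open>
  Only the nonzero values of \<open>f\<close> are summed: a range fibre may be infinite, but its
  intersection with \<open>supp f\<close> is finite for \<open>f\<close> in the Steinberg algebra of an ample Hausdorff groupoid.
\<close>

definition convolution ::
    "'g tgroupoid \<Rightarrow> ('g \<Rightarrow> 'r::comm_ring_1) \<Rightarrow> ('g \<Rightarrow> 'r) \<Rightarrow> 'g \<Rightarrow> 'r" where
  "convolution G f g x =
     (if x \<in> arrows G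
      then \<Sum>b | b \<in> arrows G \<and> rmap G b = rmap G x \<and> f b \<noteq> 0. f b * g (gmult G (ginv G b) x)
      else 0)"

text \<open>
  The Steinberg algebra need not be unital, so the ideals of \<open>HOL-Algebra\<close> do not apply. Closure
  under scalars is automatic: for \<open>f\<close> in the algebra, \<open>c f = (c 1\<^sub>K) * f\<close> for a compact open set \<open>K\<close> of
  units containing the ranges of \<open>supp f\<close>.
\<close>

definition steinberg_ideal :: "'g tgroupoid \<Rightarrow> ('g \<Rightarrow> 'r::comm_ring_1) set \<Rightarrow> bool" where
  "steinberg_ideal G I \<longleftrightarrow> I \<subseteq> steinberg G
     \<and> (\<lambda>x. 0) \<in> I
     \<and> (\<forall>f \<in> I. \<forall>g \<in> I. (\<lambda>x. f x + g x) \<in> I)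
     \<and> (\<forall>f \<in> I. (\<lambda>x. - f x) \<in> I)
     \<and> (\<forall>f \<in> I. \<forall>a \<in> steinberg G. convolution G a f \<in> I \<and> convolution G f a \<in> I)"

definition basic_ideal :: "'g tgroupoid \<Rightarrow> ('g \<Rightarrow> 'r::comm_ring_1) set \<Rightarrow> bool" where
  "basic_ideal G I \<longleftrightarrow> steinberg_ideal G I
     \<and> (\<forall>K c. compactin (unit_top G) K \<and> openin (unit_top G) K \<and> c \<noteq> 0
              \<and> (\<lambda>x. c * indicator K x) \<in> I \<longrightarrow> indicator K \<in> I)"

definition ideal_of :: "'g tgroupoid \<Rightarrow> 'g set \<Rightarrow> ('g \<Rightarrow> 'r::comm_ring_1) set" where
  "ideal_of G U = {f \<in> steinberg G. supp f \<subseteq> reduction_arrows G U}"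

definition ideal_sum :: "('g \<Rightarrow> 'r::comm_ring_1) set \<Rightarrow> ('g \<Rightarrow> 'r) set \<Rightarrow> ('g \<Rightarrow> 'r) set" where
  "ideal_sum I J = {\<lambda>x. f x + g x | f g. f \<in> I \<and> g \<in> J}"

definition open_invariant_sets :: "'g tgroupoid \<Rightarrow> 'g set set" where
  "open_invariant_sets G = {U. openin (unit_top G) U \<and> invariant G U}"

definition lattice_iso_onto_basic_ideals ::
    "'g tgroupoid \<Rightarrow> ('g set \<Rightarrow> ('g \<Rightarrow> 'r::comm_ring_1) set) \<Rightarrow> bool" where
  "lattice_iso_onto_basic_ideals G \<Phi> \<longleftrightarrow>
     bij_betw \<Phi> (open_invariant_sets G) {I. basic_ideal G I}
     \<and> (\<forall>U \<in> open_invariant_sets G. \<forall>V \<in> open_invariant_sets G.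
           \<Phi> (U \<union> V) = ideal_sum (\<Phi> U) (\<Phi> V) \<and> \<Phi> (U \<inter> V) = \<Phi> U \<inter> \<Phi> V)"

end

theory Submission imports Defs begin

text \<open>
  Write \<open>X\<close> for the unit space. Compact open slices (sets on which \<open>r\<close> and \<open>s\<close> are injective)
  form a basis, and every element of the algebra is a finite sum of scaled indicators of
  arbitrarily small slices; convolution by such an indicator is translation along the slice.

  Let \<open>G\<close> be strongly effective, \<open>I\<close> a basic ideal, and \<open>U\<close> the union of the compact open \<open>K \<subseteq> X\<close>
  with \<open>1\<^sub>K \<in> I\<close>. Then \<open>U\<close> is open and invariant, and \<open>I\<^sub>U \<subseteq> I\<close>. If some \<open>f \<in> I\<close> did not vanish
  over \<open>V = X - U\<close>, translate it so that \<open>f v = c \<noteq> 0\<close> for a unit \<open>v \<in> V\<close>. As the reduction to \<open>V\<close> is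
  effective, a compact open \<open>L\<close> meeting \<open>V\<close> can be chosen so small that the off-diagonal part of
  \<open>1\<^sub>L f 1\<^sub>L\<close> vanishes over \<open>V\<close>, whence \<open>1\<^sub>L f 1\<^sub>L - c 1\<^sub>L \<in> I\<^sub>U \<subseteq> I\<close>. So \<open>1\<^sub>L \<in> I\<close>, and \<open>L \<subseteq> U\<close>, a
  contradiction.

  Conversely, for a closed invariant \<open>V\<close>, the kernel of the action of the algebra on the free
  module over \<open>V\<close> is a basic ideal, so it is \<open>I\<^sub>U\<close> for some \<open>U\<close>, which must be disjoint from \<open>V\<close>
  because \<open>1\<^sub>K\<close> acts nontrivially if \<open>K\<close> meets \<open>V\<close>. If the reduction to \<open>V\<close> were not effective,
  some slice \<open>B\<close> without units would have arrows over \<open>V\<close>, all of them isotropy; the difference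
  of the indicators of \<open>B\<close> and \<open>s(B)\<close> then lies in the kernel but not in \<open>I\<^sub>U\<close>.
\<close>

section \<open>Groupoids and slices\<close>

context algebraic_groupoid
begin

lemma units_iff: "u \<in> units G \<longleftrightarrow> u \<in> arrows G \<and> rmap G u = u"
  unfolding units_def using r_closed r_r by force

lemma r_unit: "u \<in> units G \<Longrightarrow> rmap G u = u"
  and unit_arrow: "u \<in> units G \<Longrightarrow> u \<in> arrows G"
  by (simp_all add: units_iff)

lemma s_unit: "u \<in> units G \<Longrightarrow> smap G u = u"
  by (metis s_r units_iff)

lemma r_in_units: "x \<in> arrows G \<Longrightarrow> rmap G x \<in> units G"
  and s_in_units: "x \<in> arrows G \<Longrightarrow> smap G x \<in> units G"
  by (simp_all add: units_iff r_closed r_r s_closed r_s)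

lemma mult_arrow:
  assumes "x \<in> arrows G" "y \<in> arrows G" "smap G x = rmap G y"
  shows "gmult G x y \<in> arrows G" "rmap G (gmult G x y) = rmap G x"
    "smap G (gmult G x y) = smap G y"
  using assms mult_closed r_mult s_mult by (auto simp: composable_def)

lemma assoc:
  assumes "x \<in> arrows G" "y \<in> arrows G" "z \<in> arrows G" "smap G x = rmap G y" "smap G y = rmap G z"
  shows "gmult G (gmult G x y) z = gmult G x (gmult G y z)"
  using assms mult_assoc by (auto simp: composable_def)

lemma inv_mult_cancel:
  "\<lbrakk>x \<in> arrows G; y \<in> arrows G; smap G x = rmap G y\<rbrakk> \<Longrightarrow> gmult G (ginv G x) (gmult G x y) = y"
  by (metis assoc inv_closed left_inv left_unit s_inv)

lemma mult_inv_cancel: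
  "\<lbrakk>x \<in> arrows G; y \<in> arrows G; rmap G x = rmap G y\<rbrakk> \<Longrightarrow> gmult G x (gmult G (ginv G x) y) = y"
  by (metis assoc inv_closed left_unit r_inv right_inv s_inv)

lemma mult_cancel_inv:
  "\<lbrakk>x \<in> arrows G; y \<in> arrows G; smap G x = rmap G y\<rbrakk> \<Longrightarrow> gmult G (gmult G x y) (ginv G y) = x"
  by (metis assoc inv_closed r_inv right_inv right_unit)

lemma cancel_inv_mult:
  "\<lbrakk>x \<in> arrows G; y \<in> arrows G; smap G x = smap G y\<rbrakk> \<Longrightarrow> gmult G (gmult G x (ginv G y)) y = x"
  by (metis assoc inv_closed left_inv r_inv right_unit s_inv)

lemma inv_inv:
  assumes "x \<in> arrows G" shows "ginv G (ginv G x) = x"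
  by (metis assms cancel_inv_mult inv_closed left_inv left_unit r_inv s_inv)

lemma inv_unit: "u \<in> units G \<Longrightarrow> ginv G u = u"
  by (metis inv_closed left_inv r_unit right_unit s_inv s_unit unit_arrow)

text \<open>Invariance is demanded in one direction only; the converse is the same condition for the
  inverse arrow.\<close>

lemma invariant_iff:
  assumes "invariant G U" "x \<in> arrows G"
  shows "rmap G x \<in> U \<longleftrightarrow> smap G x \<in> U"
  using assms unfolding invariant_def by (metis inv_closed r_inv s_inv)

end

text \<open>A compact open bisection with injectivity in place of the homeomorphism clauses. In an
  ample groupoid range and source are continuous and open (\<open>continuous_r\<close>,
  \<open>open_r_image\<close> and their source versions), so injectivity is the only condition left
  to check.\<close>

definition slice :: "'g tgroupoid \<Rightarrow> 'g set \<Rightarrow> bool" where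
  "slice G B \<longleftrightarrow> openin (gtop G) B \<and> compactin (gtop G) B \<and> inj_on (rmap G) B \<and> inj_on (smap G) B"

lemma slice_arrows: "slice G B \<Longrightarrow> x \<in> B \<Longrightarrow> x \<in> arrows G"
  unfolding slice_def using openin_subset by blast

section \<open>Topology of ample groupoids: range, source, units and inversion\<close>

context ample_groupoid
begin

lemma open_bisection_basis:
  assumes "openin (gtop G) W" "x \<in> W"
  obtains B where "slice G B" "open_bisection G B" "x \<in> B" "B \<subseteq> W"
proof -
  obtain B where B: "open_bisection G B" "compactin (gtop G) B" "x \<in> B" "B \<subseteq> W"
    using ample_basis assms by blast
  then have "inj_on (rmap G) (arrows G \<inter> B)" "inj_on (smap G) (arrows G \<inter> B)" "openin (gtop G) B"
    unfolding open_bisection_def by (auto dest!: homeomorphic_imp_injective_map)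
  moreover have "arrows G \<inter> B = B"
    using B(2) compactin_subset_topspace by blast
  ultimately show thesis
    using B that unfolding slice_def by metis
qed

lemma slice_basis:
  assumes "openin (gtop G) W" "x \<in> W"
  obtains B where "slice G B" "x \<in> B" "B \<subseteq> W"
  using open_bisection_basis[OF assms] by metis

text \<open>Continuity is local, and on an open bisection the range map is a homeomorphism onto its
  image.\<close>

lemma continuous_r: "continuous_map (gtop G) (gtop G) (rmap G)"
proof -
  have "openin (gtop G) {x \<in> arrows G. rmap G x \<in> W}" if W: "openin (gtop G) W" for W
  proof (subst openin_subopen, safe)
    fix x assume x: "x \<in> arrows G" "rmap G x \<in> W"
    obtain B where B: "slice G B" "open_bisection G B" "x \<in> B"
      using open_bisection_basis[OF openin_topspace x(1)] by metis
    have oB: "openin (gtop G) B"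
      using B(1) by (simp add: slice_def)
    have "continuous_map (subtopology (gtop G) B) (subtopology (unit_top G) (rmap G ` B)) (rmap G)"
      using B(2) by (auto simp: open_bisection_def dest: homeomorphic_imp_continuous_map)
    then have "continuous_map (subtopology (gtop G) B) (gtop G) (rmap G)"
      by (simp add: unit_top_def continuous_map_in_subtopology)
    then have "openin (subtopology (gtop G) B) {y \<in> topspace (subtopology (gtop G) B). rmap G y \<in> W}"
      using W by (rule openin_continuous_map_preimage)
    then have "openin (gtop G) {y \<in> topspace (subtopology (gtop G) B). rmap G y \<in> W}"
      using oB openin_trans_full by blast
    moreover have "x \<in> {y \<in> topspace (subtopology (gtop G) B). rmap G y \<in> W}"
      using x B by simp
    ultimately show "\<exists>T. openin (gtop G) T \<and> x \<in> T \<and> T \<subseteq> {x \<in> arrows G. rmap G x \<in> W}"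
      by (metis (no_types, lifting) Collect_mono IntD1 topspace_subtopology)
  qed
  then show ?thesis
    by (auto simp: continuous_map_def r_closed)
qed

lemma continuous_s: "continuous_map (gtop G) (gtop G) (smap G)"
  using continuous_map_compose[OF continuous_inv continuous_r]
  by (rule continuous_map_eq) (simp add: r_inv)

lemmas open_r_preimage = openin_continuous_map_preimage[OF continuous_r]
  and open_s_preimage = openin_continuous_map_preimage[OF continuous_s]

lemma open_units: "openin (gtop G) (units G)"
proof (subst openin_subopen, safe)
  fix x assume x: "x \<in> units G"
  then obtain B where B: "slice G B" "x \<in> B"
    using slice_basis[OF openin_topspace] unit_arrow by metis
  let ?T = "B \<inter> {y \<in> arrows G. rmap G y \<in> B}"
  have "?T \<subseteq> units G"
    \<comment> \<open>\<open>y\<close> and \<open>r y\<close> both lie in \<open>B\<close> and have the same range.\<close>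
  proof clarify
    fix y assume "y \<in> B" "rmap G y \<in> B" "y \<in> arrows G"
    then have "rmap G y = y"
      using B(1) r_r by (auto simp: slice_def inj_on_def)
    then show "y \<in> units G"
      using \<open>y \<in> arrows G\<close> by (simp add: units_iff)
  qed
  moreover have "openin (gtop G) ?T"
    using B(1) open_r_preimage by (auto simp: slice_def)
  moreover have "x \<in> ?T"
    using x B(2) by (simp add: units_iff)
  ultimately show "\<exists>T. openin (gtop G) T \<and> x \<in> T \<and> T \<subseteq> units G"
    by blast
qed

lemma openin_unit_top: "openin (unit_top G) U \<longleftrightarrow> openin (gtop G) U \<and> U \<subseteq> units G"
  unfolding unit_top_def using open_units by (rule openin_open_subtopology)

lemma compactin_unit_top: "compactin (unit_top G) U \<longleftrightarrow> compactin (gtop G) U \<and> U \<subseteq> units G"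
  unfolding unit_top_def by (rule compactin_subtopology)

text \<open>Open bisections form a basis and have open ranges.\<close>

lemma open_r_image:
  assumes "openin (gtop G) W" shows "openin (gtop G) (rmap G ` W)"
proof (subst openin_subopen, safe)
  fix x assume x: "x \<in> W"
  then obtain B where B: "open_bisection G B" "x \<in> B" "B \<subseteq> W"
    using open_bisection_basis[OF assms] by metis
  then have "openin (gtop G) (rmap G ` B)"
    by (simp add: open_bisection_def openin_unit_top)
  then show "\<exists>T. openin (gtop G) T \<and> rmap G x \<in> T \<and> T \<subseteq> rmap G ` W"
    using B by blast
qed

lemma inv_image: "W \<subseteq> arrows G \<Longrightarrow> ginv G ` W = {x \<in> arrows G. ginv G x \<in> W}"
  using inv_inv inv_closed by force

lemma open_inv_image:
  assumes "openin (gtop G) W" shows "openin (gtop G) (ginv G ` W)"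
  using assms by (simp add: inv_image openin_subset openin_continuous_map_preimage[OF continuous_inv])

lemma open_s_image:
  assumes "openin (gtop G) W" shows "openin (gtop G) (smap G ` W)"
proof -
  have "smap G ` W = rmap G ` ginv G ` W"
    using openin_subset[OF assms] r_inv by force
  then show ?thesis
    using assms by (simp add: open_inv_image open_r_image)
qed

lemma slice_inv:
  assumes "slice G B" shows "slice G (ginv G ` B)"
proof -
  have "inj_on (rmap G) (ginv G ` B)" "inj_on (smap G) (ginv G ` B)"
    using assms slice_arrows[OF assms] by (auto simp: slice_def inj_on_def s_inv r_inv)
  then show ?thesis
    using assms open_inv_image image_compactin[OF _ continuous_inv] by (simp add: slice_def)
qed

lemma slice_s_image:
  assumes "slice G B"
  shows "openin (unit_top G) (smap G ` B)" "compactin (unit_top G) (smap G ` B)"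
  using assms open_s_image image_compactin[OF _ continuous_s] slice_arrows[OF assms] s_in_units
  by (auto simp: slice_def openin_unit_top compactin_unit_top)

lemma unit_set_slice:
  assumes "openin (unit_top G) K" "compactin (unit_top G) K"
  shows "slice G K"
  using assms r_unit s_unit
  by (auto simp: slice_def openin_unit_top compactin_unit_top inj_on_def subset_iff)

text \<open>Continuity of \<open>(a, y)\<close> \<mapsto> \<open>a\<close>-inverse times
  \<open>y\<close> at \<open>(b, x)\<close>, in terms of a box of neighbourhoods. It makes
  convolution products locally constant.\<close>

lemma continuous_division:
  assumes "openin (gtop G) W" "b \<in> arrows G" "x \<in> arrows G" "rmap G b = rmap G x"
    "gmult G (ginv G b) x \<in> W"
  obtains A N where "openin (gtop G) A" "openin (gtop G) N" "b \<in> A" "x \<in> N"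
    "\<And>a y. \<lbrakk>a \<in> A; y \<in> N; rmap G a = rmap G y\<rbrakk> \<Longrightarrow> gmult G (ginv G a) y \<in> W"
proof -
  let ?P = "prod_topology (gtop G) (gtop G)"
  have "openin (subtopology ?P (composable G))
      {z \<in> topspace (subtopology ?P (composable G)). (\<lambda>(x, y). gmult G x y) z \<in> W}"
    using continuous_mult assms(1) by (rule openin_continuous_map_preimage)
  moreover have comp: "composable G \<subseteq> topspace ?P"
    by (auto simp: composable_def)
  ultimately obtain T where T: "openin ?P T"
      "{z \<in> composable G. (\<lambda>(x, y). gmult G x y) z \<in> W} = T \<inter> composable G"
    by (auto simp: openin_subtopology Int_absorb1)
  have cc: "(ginv G a, y) \<in> composable G"
    if "a \<in> arrows G" "y \<in> arrows G" "rmap G a = rmap G y" for a y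
    using that by (simp add: composable_def inv_closed s_inv)
  have "(ginv G b, x) \<in> T \<inter> composable G"
    using T(2)[symmetric] cc assms by auto
  then obtain A N where AN: "openin (gtop G) A" "openin (gtop G) N" "ginv G b \<in> A" "x \<in> N" "A \<times> N \<subseteq> T"
    using T(1) unfolding openin_prod_topology_alt by (metis IntD1)
  show thesis
  proof
    show "openin (gtop G) {a \<in> arrows G. ginv G a \<in> A}"
      using AN by (rule_tac openin_continuous_map_preimage[OF continuous_inv])
    show "gmult G (ginv G a) y \<in> W"
      if "a \<in> {a \<in> arrows G. ginv G a \<in> A}" "y \<in> N" "rmap G a = rmap G y" for a y
    proof -
      have "(ginv G a, y) \<in> T \<inter> composable G"
        using that AN cc openin_subset[OF AN(2)] by blast
      then show ?thesis
        using T(2)[symmetric] by auto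
    qed
  qed (use AN assms in auto)
qed

end

section \<open>Closedness and compactness from the Hausdorff condition\<close>

locale hausdorff_ample_groupoid = ample_groupoid +
  assumes hausdorff: "Hausdorff_space (gtop G)"
begin

text \<open>Units are the fixed points of the range map, and an equalizer of continuous maps into a
  Hausdorff space is closed. Together with \<open>open_units\<close> this lets functions be split
  into a part on the units and a part off them.\<close>

lemma closed_units: "closedin (gtop G) (units G)"
proof -
  have "closedin (gtop G) {x \<in> arrows G. rmap G x = id x}"
    using hausdorff continuous_r continuous_map_id by (rule closedin_continuous_maps_eq)
  then show ?thesis
    by (simp add: units_iff[symmetric])
qed

lemma slice_closed: "slice G B \<Longrightarrow> closedin (gtop G) B"
  using hausdorff compactin_imp_closedin by (auto simp: slice_def)

lemma slice_subset:
  "\<lbrakk>slice G B; C \<subseteq> B; openin (gtop G) C; closedin (gtop G) C\<rbrakk> \<Longrightarrow> slice G C"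
  using closed_compactin by (auto simp: slice_def intro: inj_on_subset)

text \<open>The composable pairs form an equalizer, hence a closed set, so those in
  \<open>A \<times> S\<close> form a compact set, and multiplication maps it continuously onto the
  set of products.\<close>

lemma compact_products:
  assumes "compactin (gtop G) A" "compactin (gtop G) S"
  shows "compactin (gtop G) {gmult G a y | a y. a \<in> A \<and> y \<in> S \<and> smap G a = rmap G y}"
proof -
  let ?P = "prod_topology (gtop G) (gtop G)"
  have "closedin ?P {z \<in> topspace ?P. (smap G \<circ> fst) z = (rmap G \<circ> snd) z}"
    using hausdorff
    by (rule closedin_continuous_maps_eq)
       (rule continuous_map_compose[OF continuous_map_fst continuous_s]
          continuous_map_compose[OF continuous_map_snd continuous_r])+
  moreover have "composable G = {z \<in> topspace ?P. (smap G \<circ> fst) z = (rmap G \<circ> snd) z}"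
    by (auto simp: composable_def)
  ultimately have "compactin ?P (composable G \<inter> A \<times> S)"
    using assms by (auto intro: closed_Int_compactin simp: compactin_Times)
  \<comment> \<open>Multiplication is continuous only on the composable pairs, so compactness has to
    be moved to that subspace.\<close>
  then have "compactin (subtopology ?P (composable G)) (composable G \<inter> A \<times> S)"
    by (simp add: compactin_subtopology)
  then have "compactin (gtop G) ((\<lambda>(x, y). gmult G x y) ` (composable G \<inter> A \<times> S))"
    using continuous_mult by (rule image_compactin)
  moreover have "(\<lambda>(x, y). gmult G x y) ` (composable G \<inter> A \<times> S)
      = {gmult G a y | a y. a \<in> A \<and> y \<in> S \<and> smap G a = rmap G y}"
    using assms[THEN compactin_subset_topspace] by (auto simp: composable_def image_iff)
  ultimately show ?thesis by simp
qed

end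

section \<open>The Steinberg algebra\<close>

lemma locally_constantE:
  assumes "locally_constant T f" "x \<in> topspace T"
  obtains W where "openin T W" "x \<in> W" "\<forall>y\<in>W. f y = f x"
proof -
  have "\<exists>W. openin T W \<and> x \<in> W \<and> (\<forall>y\<in>W. f y = f x)"
    using assms unfolding locally_constant_def by (rule bspec)
  then show thesis
    using that by (elim exE conjE)
qed

lemma openin_locally_constant:
  assumes "locally_constant T f"
  shows "openin T {x \<in> topspace T. P (f x)}"
proof (subst openin_subopen, safe)
  fix x assume x: "x \<in> topspace T" "P (f x)"
  obtain W where W: "openin T W" "x \<in> W" "\<forall>y\<in>W. f y = f x"
    using assms x(1) by (rule locally_constantE)
  have "W \<subseteq> {x \<in> topspace T. P (f x)}"
  proof
    fix y assume "y \<in> W"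
    then have "f y = f x" "y \<in> topspace T"
      using W(3) openin_subset[OF W(1)] by blast+
    then show "y \<in> {x \<in> topspace T. P (f x)}"
      using x(2) by simp
  qed
  then show "\<exists>V. openin T V \<and> x \<in> V \<and> V \<subseteq> {x \<in> topspace T. P (f x)}"
    using W by blast
qed

lemma closedin_locally_constant:
  assumes "locally_constant T f"
  shows "closedin T {x \<in> topspace T. P (f x)}"
proof -
  have "topspace T - {x \<in> topspace T. P (f x)} = {x \<in> topspace T. \<not> P (f x)}"
    by auto
  then show ?thesis
    using openin_locally_constant[OF assms, of "\<lambda>y. \<not> P y"] by (simp add: closedin_def)
qed

lemma locally_constant_combine:
  assumes "locally_constant T f" "locally_constant T g"
  shows "locally_constant T (\<lambda>x. h (f x) (g x))"
  unfolding locally_constant_def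
proof
  fix x assume x: "x \<in> topspace T"
  obtain V where "openin T V" "x \<in> V" "\<forall>y\<in>V. f y = f x"
    using assms(1) x by (rule locally_constantE)
  moreover obtain W where "openin T W" "x \<in> W" "\<forall>y\<in>W. g y = g x"
    using assms(2) x by (rule locally_constantE)
  ultimately show "\<exists>W. openin T W \<and> x \<in> W \<and> (\<forall>y\<in>W. h (f y) (g y) = h (f x) (g x))"
    by (metis (no_types, lifting) IntE IntI openin_Int)
qed

lemma locally_constant_const: "locally_constant T (\<lambda>x. c)"
  unfolding locally_constant_def by blast

lemma locally_constant_mem:
  assumes "openin T A" "closedin T A"
  shows "locally_constant T (\<lambda>x. x \<in> A)"
  unfolding locally_constant_def
proof
  fix x assume "x \<in> topspace T"
  then show "\<exists>W. openin T W \<and> x \<in> W \<and> (\<forall>y\<in>W. (y \<in> A) = (x \<in> A))"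
    using assms by (cases "x \<in> A") (auto simp: closedin_def intro: exI[of _ A] exI[of _ "topspace T - A"])
qed

lemma locally_constant_if:
  assumes "openin T A" "closedin T A" "locally_constant T f" "locally_constant T g"
  shows "locally_constant T (\<lambda>x. if x \<in> A then f x else g x)"
  \<comment> \<open>Three functions are combined by two binary steps: \<open>f\<close> and
    \<open>g\<close> are paired first, then the truth value of \<open>x \<in> A\<close> selects a
    component.\<close>
  using locally_constant_combine[OF locally_constant_mem[OF assms(1,2)]
      locally_constant_combine[OF assms(3,4), of Pair], of "\<lambda>b p. if b then fst p else snd p"]
  by (simp cong: if_cong)

section \<open>Membership in the algebra, decomposition into slices, and convolution\<close>

context hausdorff_ample_groupoid
begin

lemma steinberg_supp:
  assumes "f \<in> steinberg G"
  shows "compactin (gtop G) (supp f)" "openin (gtop G) (supp f)" "closedin (gtop G) (supp f)"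
    "supp f \<subseteq> arrows G" "f x \<noteq> 0 \<Longrightarrow> x \<in> arrows G"
proof -
  show c: "compactin (gtop G) (supp f)"
    using assms by (simp add: steinberg_def)
  show sub: "supp f \<subseteq> arrows G"
    using c by (rule compactin_subset_topspace)
  show "openin (gtop G) (supp f)"
    using openin_locally_constant[of "gtop G" f "\<lambda>c. c \<noteq> 0"] assms sub
    by (simp add: steinberg_def supp_def Collect_conj_eq Int_absorb1)
  show "closedin (gtop G) (supp f)"
    using hausdorff c by (rule compactin_imp_closedin)
  show "f x \<noteq> 0 \<Longrightarrow> x \<in> arrows G"
    using sub by (auto simp: supp_def)
qed

text \<open>The support of a locally constant function is closed, so it is compact once some compact
  set contains it.\<close>

lemma steinbergI:
  assumes "locally_constant (gtop G) f" "supp f \<subseteq> K" "compactin (gtop G) K"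
  shows "f \<in> steinberg G"
proof -
  have "supp f = {x \<in> arrows G. f x \<noteq> 0}"
    using assms(2) compactin_subset_topspace[OF assms(3)] by (auto simp: supp_def)
  then have "closedin (gtop G) (supp f)"
    using closedin_locally_constant[OF assms(1), of "\<lambda>c. c \<noteq> 0"] by simp
  then show ?thesis
    using assms closed_compactin by (auto simp: steinberg_def)
qed

lemma steinberg_zero: "(\<lambda>x. 0) \<in> steinberg G"
  by (rule steinbergI[of _ "{}"]) (auto simp: locally_constant_const supp_def)

lemma steinberg_add:
  assumes "f \<in> steinberg G" "g \<in> steinberg G"
  shows "(\<lambda>x. f x + g x) \<in> steinberg G"
proof (rule steinbergI[of _ "supp f \<union> supp g"])
  show "locally_constant (gtop G) (\<lambda>x. f x + g x)"
    using assms by (simp add: steinberg_def locally_constant_combine)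
qed (use assms in \<open>auto simp: steinberg_supp compactin_Un\<close>, auto simp: supp_def)

lemma steinberg_scale:
  assumes "f \<in> steinberg G"
  shows "(\<lambda>x. c * f x) \<in> steinberg G"
proof (rule steinbergI[of _ "supp f"])
  show "locally_constant (gtop G) (\<lambda>x. c * f x)"
    using assms locally_constant_combine[of _ f f "\<lambda>a b. c * a"] by (simp add: steinberg_def)
qed (use assms in \<open>auto simp: steinberg_supp\<close>, auto simp: supp_def)

lemma steinberg_uminus: "f \<in> steinberg G \<Longrightarrow> (\<lambda>x. - f x) \<in> steinberg G"
  using steinberg_scale[of f "-1"] by simp

lemma steinberg_restrict:
  assumes "f \<in> steinberg G" "openin (gtop G) A" "closedin (gtop G) A"
  shows "(\<lambda>x. if x \<in> A then 0 else f x) \<in> steinberg G"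
  using assms
  by (auto intro!: steinbergI[of _ "supp f"] locally_constant_if locally_constant_const
      simp: steinberg_supp) (auto simp: steinberg_def supp_def split: if_splits)

lemma steinberg_slice:
  assumes "slice G B"
  shows "(\<lambda>x. c * indicator B x) \<in> steinberg G"
proof (rule steinbergI[of _ B])
  show "locally_constant (gtop G) (\<lambda>x. c * indicator B x)"
    using assms locally_constant_if[of "gtop G" B "\<lambda>_. c" "\<lambda>_. 0"] slice_closed[OF assms]
    by (simp add: slice_def locally_constant_const indicator_def of_bool_def if_distrib cong: if_cong)
qed (use assms in \<open>auto simp: slice_def supp_def indicator_def split: if_splits\<close>)

lemma steinberg_indicator: "slice G B \<Longrightarrow> indicator B \<in> steinberg G"
  using steinberg_slice[of B 1] by simp

text \<open>The decomposition of \<open>f\<close> into scaled indicators of slices, as an induction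
  rule. \<open>Q\<close> expresses how small the slices must be; it has to hold near each point of
  the support and pass to subsets. Compactness leaves finitely many slices, which are peeled off one
  at a time.\<close>

lemma steinberg_induct [consumes 1, case_names small subset zero add slice]:
  assumes f: "f \<in> steinberg G"
    and small: "\<And>x. f x \<noteq> 0 \<Longrightarrow> \<exists>W. openin (gtop G) W \<and> x \<in> W \<and> Q W"
    and subset: "\<And>A B. \<lbrakk>Q B; A \<subseteq> B\<rbrakk> \<Longrightarrow> Q A"
    and zero: "P (\<lambda>x. 0)"
    and add: "\<And>f g. \<lbrakk>f \<in> steinberg G; g \<in> steinberg G; P f; P g\<rbrakk> \<Longrightarrow> P (\<lambda>x. f x + g x)"
    and slice: "\<And>c B. \<lbrakk>slice G B; Q B\<rbrakk> \<Longrightarrow> P (\<lambda>x. c * indicator B x)"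
  shows "P f"
proof -
  \<comment> \<open>On a slice of the cover \<open>f\<close> may also vanish: this weaker form of
    constancy survives when \<open>f\<close> is set to zero on another slice.\<close>
  let ?C = "{B. slice G B \<and> Q B \<and> (\<exists>c. \<forall>x\<in>B. f x = 0 \<or> f x = c)}"
  have "\<exists>B\<in>?C. x \<in> B" if x: "x \<in> supp f" for x
  proof -
    obtain W where W: "openin (gtop G) W" "x \<in> W" "Q W"
      using small x by (auto simp: supp_def)
    have "x \<in> arrows G" "locally_constant (gtop G) f"
      using f x steinberg_supp(4)[OF f] by (auto simp: steinberg_def)
    then obtain V where V: "openin (gtop G) V" "x \<in> V" "\<forall>y\<in>V. f y = f x"
      by (metis locally_constantE)
    obtain B where B: "slice G B" "x \<in> B" "B \<subseteq> V \<inter> W"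
      using slice_basis[of "V \<inter> W" x] V W by auto
    moreover have "\<forall>y\<in>B. f y = 0 \<or> f y = f x"
      using V(3) B(3) by blast
    moreover have "Q B"
      using subset[OF W(3)] B(3) by blast
    ultimately show ?thesis
      using B by blast
  qed
  then have "supp f \<subseteq> \<Union>?C"
    by blast
  then obtain F where F: "finite F" "F \<subseteq> ?C" "supp f \<subseteq> \<Union>F"
    using compactinD[OF steinberg_supp(1)[OF f], of ?C] by (auto simp: slice_def)
  then show ?thesis
    using f
  proof (induction F arbitrary: f)
    case empty
    then have "f = (\<lambda>x. 0)"
      by (auto simp: supp_def)
    then show ?case
      using zero by simp
  next
    case (insert B F)
    then have B: "slice G B" "Q B" and "\<exists>c. \<forall>x\<in>B. f x = 0 \<or> f x = c"
      by simp_all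
    then obtain c where c: "\<forall>x\<in>B. f x = 0 \<or> f x = c"
      by (elim exE)
    \<comment> \<open>\<open>?g\<close> is what remains of \<open>f\<close> off \<open>B\<close>. On
      \<open>?D\<close>, clopen and hence again a slice, \<open>f\<close> equals \<open>c\<close>;
      on the rest of \<open>B\<close> it is zero.\<close>
    let ?g = "\<lambda>x. if x \<in> B then 0 else f x" and ?D = "B \<inter> supp f"
    have clopen: "openin (gtop G) B" "closedin (gtop G) B"
      using B slice_closed by (auto simp: slice_def)
    have g: "?g \<in> steinberg G"
      using insert.prems clopen by (simp add: steinberg_restrict)
    have D: "slice G ?D"
      using clopen steinberg_supp[OF insert.prems(3)] by (auto intro!: slice_subset[OF B(1)])
    have "P ?g"
    proof (rule insert.IH)
      show "F \<subseteq> {B. slice G B \<and> Q B \<and> (\<exists>c. \<forall>x\<in>B. ?g x = 0 \<or> ?g x = c)}"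
      proof
        fix C assume "C \<in> F"
        then have "C \<in> {B. slice G B \<and> Q B \<and> (\<exists>c. \<forall>x\<in>B. f x = 0 \<or> f x = c)}"
          using insert.prems(1) by (meson insertI2 subsetD)
        then have C: "slice G C" "Q C" and "\<exists>c. \<forall>x\<in>C. f x = 0 \<or> f x = c"
          by simp_all
        then obtain d where d: "\<forall>x\<in>C. f x = 0 \<or> f x = d"
          by (elim exE)
        have "\<forall>x\<in>C. ?g x = 0 \<or> ?g x = d"
        proof
          fix x assume "x \<in> C"
          with d have "f x = 0 \<or> f x = d"
            by (rule bspec)
          then show "?g x = 0 \<or> ?g x = d"
            by simp
        qed
        with C show "C \<in> {B. slice G B \<and> Q B \<and> (\<exists>c. \<forall>x\<in>B. ?g x = 0 \<or> ?g x = c)}"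
          by (intro CollectI conjI exI)
      qed
      show "supp ?g \<subseteq> \<Union>F"
        using insert.prems(2) by (auto simp: supp_def split: if_splits)
    qed (rule g)
    moreover have "P (\<lambda>x. c * indicator ?D x)"
      using slice[OF D] subset[OF B(2)] by blast
    moreover have "f = (\<lambda>x. c * indicator ?D x + ?g x)"
    proof
      fix x show "f x = c * indicator ?D x + ?g x"
      proof (cases "x \<in> B")
        case True
        then have "f x = 0 \<or> f x = c"
          using c by blast
        then show ?thesis
          using True by (cases "f x = 0") (simp_all add: supp_def indicator_def)
      qed simp
    qed
    ultimately show ?case
      using add[OF steinberg_slice[OF D] g] by metis
  qed
qed

text \<open>A slice meets each range or source fibre in at most one arrow, and finiteness passes to
  sums.\<close>

lemma finite_fibre:
  assumes "f \<in> steinberg G"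
  shows "finite {b \<in> arrows G. rmap G b = u \<and> f b \<noteq> 0}" "finite {b \<in> arrows G. smap G b = u \<and> f b \<noteq> 0}"
proof -
  have "finite {b. rmap G b = u \<and> f b \<noteq> 0} \<and> finite {b. smap G b = u \<and> f b \<noteq> 0}"
    using assms
  proof (induction rule: steinberg_induct[where Q = "\<lambda>_. True"])
    case (add f g)
    have "{b. t b = u \<and> f b + g b \<noteq> 0} \<subseteq> {b. t b = u \<and> f b \<noteq> 0} \<union> {b. t b = u \<and> g b \<noteq> 0}" for t
      by auto
    then show ?case
      using add by (meson finite_UnI finite_subset)
  next
    case (slice c B)
    let ?R = "{b \<in> B. rmap G b = u}" and ?S = "{b \<in> B. smap G b = u}"
    have "finite (rmap G ` ?R)" "finite (smap G ` ?S)"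
      by (auto intro: finite_subset[of _ "{u}"])
    then have "finite ?R" "finite ?S"
      using slice by (auto elim!: finite_imageD simp: slice_def inj_on_def)
    moreover have "{b. rmap G b = u \<and> c * indicator B b \<noteq> 0} \<subseteq> ?R"
      "{b. smap G b = u \<and> c * indicator B b \<noteq> 0} \<subseteq> ?S"
      by (auto simp: indicator_def split: if_splits)
    ultimately show ?case
      by (meson finite_subset)
  qed (use openin_topspace steinberg_supp(5)[OF assms] in auto)
  then show "finite {b \<in> arrows G. rmap G b = u \<and> f b \<noteq> 0}" "finite {b \<in> arrows G. smap G b = u \<and> f b \<noteq> 0}"
    by simp_all
qed

text \<open>The index set in the definition depends on \<open>f\<close>; enlarging it to any finite
  \<open>S\<close> in the fibre lets different functions be summed over a common set.\<close>

lemma convolution_eq_sum: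
  assumes "x \<in> arrows G" "finite S" "\<And>b. b \<in> S \<Longrightarrow> b \<in> arrows G \<and> rmap G b = rmap G x"
    "\<And>b. \<lbrakk>b \<in> arrows G; rmap G b = rmap G x; f b \<noteq> 0\<rbrakk> \<Longrightarrow> b \<in> S"
  shows "convolution G f g x = (\<Sum>b\<in>S. f b * g (gmult G (ginv G b) x))"
proof -
  have "(\<Sum>b | b \<in> arrows G \<and> rmap G b = rmap G x \<and> f b \<noteq> 0. f b * g (gmult G (ginv G b) x))
      = (\<Sum>b\<in>S. f b * g (gmult G (ginv G b) x))"
  proof (rule sum.mono_neutral_left[OF assms(2)])
    show "{b \<in> arrows G. rmap G b = rmap G x \<and> f b \<noteq> 0} \<subseteq> S"
      using assms(4) by blast
    show "\<forall>b \<in> S - {b \<in> arrows G. rmap G b = rmap G x \<and> f b \<noteq> 0}. f b * g (gmult G (ginv G b) x) = 0"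
      using assms(3) by (metis (mono_tags, lifting) DiffE mem_Collect_eq mult_zero_left)
  qed
  then show ?thesis
    using assms(1) by (simp add: convolution_def)
qed

lemma convolution_add_left:
  assumes "f \<in> steinberg G" "f' \<in> steinberg G"
  shows "convolution G (\<lambda>x. f x + f' x) g = (\<lambda>x. convolution G f g x + convolution G f' g x)"
proof
  fix x
  show "convolution G (\<lambda>x. f x + f' x) g x = convolution G f g x + convolution G f' g x"
  proof (cases "x \<in> arrows G")
    case x: True
    let ?S = "{b \<in> arrows G. rmap G b = rmap G x \<and> f b \<noteq> 0} \<union> {b \<in> arrows G. rmap G b = rmap G x \<and> f' b \<noteq> 0}"
    have "finite ?S"
      using assms by (simp add: finite_fibre)
    have "convolution G (\<lambda>x. f x + f' x) g x = (\<Sum>b\<in>?S. (f b + f' b) * g (gmult G (ginv G b) x))"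
      "convolution G f g x = (\<Sum>b\<in>?S. f b * g (gmult G (ginv G b) x))"
      "convolution G f' g x = (\<Sum>b\<in>?S. f' b * g (gmult G (ginv G b) x))"
      by (rule convolution_eq_sum[OF x \<open>finite ?S\<close>]; force)+
    then show ?thesis
      by (simp add: distrib_right sum.distrib)
  qed (simp add: convolution_def)
qed

lemma convolution_add_right:
  "convolution G f (\<lambda>x. g x + g' x) = (\<lambda>x. convolution G f g x + convolution G f g' x)"
  by (auto simp: convolution_def fun_eq_iff distrib_left sum.distrib)

lemma convolution_zero_left: "convolution G (\<lambda>x. 0) g = (\<lambda>x. 0)"
  and convolution_zero_right: "convolution G f (\<lambda>x. 0) = (\<lambda>x. 0)"
  by (auto simp: convolution_def fun_eq_iff)

lemma convolution_nonzero:
  assumes "convolution G f g x \<noteq> 0"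
  obtains b y where "b \<in> arrows G" "y \<in> arrows G" "f b \<noteq> 0" "g y \<noteq> 0" "smap G b = rmap G y" "x = gmult G b y"
proof -
  have x: "x \<in> arrows G"
    using assms by (auto simp: convolution_def split: if_splits)
  then have "(\<Sum>b | b \<in> arrows G \<and> rmap G b = rmap G x \<and> f b \<noteq> 0. f b * g (gmult G (ginv G b) x)) \<noteq> 0"
    using assms by (simp add: convolution_def)
  then obtain b where "b \<in> arrows G" "rmap G b = rmap G x" "f b * g (gmult G (ginv G b) x) \<noteq> 0"
    by (auto elim!: sum.not_neutral_contains_not_neutral)
  moreover have "f b \<noteq> 0" "g (gmult G (ginv G b) x) \<noteq> 0"
    using calculation(3) by auto
  ultimately show thesis
    using x that[of b "gmult G (ginv G b) x"]
    by (simp add: mult_arrow mult_inv_cancel inv_closed s_inv r_inv)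
qed

text \<open>The slice contains at most one arrow with the range of \<open>x\<close>, so at most one
  summand survives.\<close>

lemma convolution_slice_left:
  assumes B: "slice G B" and x: "x \<in> arrows G"
  shows "\<lbrakk>b \<in> B; rmap G b = rmap G x\<rbrakk> \<Longrightarrow>
      convolution G (\<lambda>x. c * indicator B x) g x = c * g (gmult G (ginv G b) x)"
    and "rmap G x \<notin> rmap G ` B \<Longrightarrow> convolution G (\<lambda>x. c * indicator B x) g x = 0"
proof -
  assume b: "b \<in> B" "rmap G b = rmap G x"
  have only: "a = b" if "a \<in> B" "rmap G a = rmap G x" for a
    using B b that by (metis inj_onD slice_def)
  have "convolution G (\<lambda>x. c * indicator B x) g x
      = (\<Sum>a\<in>{b}. c * indicator B a * g (gmult G (ginv G a) x))"
  proof (rule convolution_eq_sum[OF x])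
    show "a \<in> arrows G \<and> rmap G a = rmap G x" if "a \<in> {b}" for a
      using that b slice_arrows[OF B] by simp
    show "a \<in> {b}" if "a \<in> arrows G" "rmap G a = rmap G x" "c * indicator B a \<noteq> 0" for a
      using that only[of a] by (cases "a \<in> B") simp_all
  qed simp
  then show "convolution G (\<lambda>x. c * indicator B x) g x = c * g (gmult G (ginv G b) x)"
    using b by simp
next
  assume "rmap G x \<notin> rmap G ` B"
  have "convolution G (\<lambda>x. c * indicator B x) g x
      = (\<Sum>a\<in>{}. c * indicator B a * g (gmult G (ginv G a) x))"
  proof (rule convolution_eq_sum[OF x])
    show "a \<in> {}" if "a \<in> arrows G" "rmap G a = rmap G x" "c * indicator B a \<noteq> 0" for a
      using that \<open>rmap G x \<notin> rmap G ` B\<close> by (cases "a \<in> B") (metis imageI, simp)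
  qed simp_all
  then show "convolution G (\<lambda>x. c * indicator B x) g x = 0"
    by simp
qed

text \<open>The sum runs over the left factor \<open>a\<close>, and a summand survives only if
  \<open>a\<close>-inverse times \<open>x\<close> lies in \<open>B\<close>. That arrow has the
  source of \<open>b\<close>, so it is \<open>b\<close>, which forces \<open>a\<close> to be
  \<open>x\<close> times the inverse of \<open>b\<close>.\<close>

lemma convolution_slice_right:
  assumes f: "f \<in> steinberg G" and B: "slice G B" and x: "x \<in> arrows G"
  shows "\<lbrakk>b \<in> B; smap G b = smap G x\<rbrakk> \<Longrightarrow>
      convolution G f (\<lambda>x. c * indicator B x) x = f (gmult G x (ginv G b)) * c"
    and "smap G x \<notin> smap G ` B \<Longrightarrow> convolution G f (\<lambda>x. c * indicator B x) x = 0"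
proof -
  assume b: "b \<in> B" "smap G b = smap G x"
  let ?a = "gmult G x (ginv G b)"
  \<comment> \<open>\<open>?a\<close> is inserted by hand since \<open>f\<close> may vanish
    there.\<close>
  let ?S = "insert ?a {b \<in> arrows G. rmap G b = rmap G x \<and> f b \<noteq> 0}"
  have bG: "b \<in> arrows G"
    using slice_arrows[OF B b(1)] .
  have a: "?a \<in> arrows G" "rmap G ?a = rmap G x" "gmult G (ginv G ?a) x = b"
  proof -
    show *: "?a \<in> arrows G" "rmap G ?a = rmap G x"
      using b bG x by (simp_all add: mult_arrow inv_closed r_inv)
    have "smap G ?a = rmap G b" "gmult G ?a b = x"
      using b bG x by (simp_all add: mult_arrow inv_closed r_inv s_inv cancel_inv_mult)
    then show "gmult G (ginv G ?a) x = b"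
      using inv_mult_cancel[OF *(1) bG] by simp
  qed
  have fin: "finite ?S"
    using finite_fibre(1)[OF f] by simp
  have only: "a' = ?a" if "a' \<in> arrows G" "rmap G a' = rmap G x" "gmult G (ginv G a') x \<in> B" for a'
  proof -
    have "smap G (gmult G (ginv G a') x) = smap G b"
      using that b x by (simp add: mult_arrow inv_closed s_inv)
    then have "gmult G (ginv G a') x = b"
      using that B b by (auto simp: slice_def inj_on_def)
    then have "gmult G a' b = x" "smap G a' = rmap G b"
      using that x mult_inv_cancel[of a' x] mult_arrow(2)[of "ginv G a'" x]
      by (auto simp: inv_closed s_inv r_inv)
    then show ?thesis
      using mult_cancel_inv[OF that(1) bG] by simp
  qed
  have "convolution G f (\<lambda>x. c * indicator B x) x
      = (\<Sum>a'\<in>?S. f a' * (c * indicator B (gmult G (ginv G a') x)))"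
  proof (rule convolution_eq_sum[OF x fin])
    show "a' \<in> arrows G \<and> rmap G a' = rmap G x" if "a' \<in> ?S" for a'
      using that by (elim insertE) (simp_all add: a(1,2))
    show "a' \<in> ?S" if "a' \<in> arrows G" "rmap G a' = rmap G x" "f a' \<noteq> 0" for a'
      using that by simp
  qed
  also have "\<dots> = (\<Sum>a'\<in>?S. if a' = ?a then f ?a * c else 0)"
  proof (rule sum.cong[OF refl])
    fix a' assume a': "a' \<in> ?S"
    show "f a' * (c * indicator B (gmult G (ginv G a') x)) = (if a' = ?a then f ?a * c else 0)"
    proof (cases "a' = ?a")
      case True
      then show ?thesis by (simp add: a(3) b(1))
    next
      case False
      then have "gmult G (ginv G a') x \<notin> B"
        using a' only[of a'] by blast
      then show ?thesis using False by simp
    qed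
  qed
  also have "\<dots> = f ?a * c"
    using fin by (subst sum.delta) auto
  finally show "convolution G f (\<lambda>x. c * indicator B x) x = f ?a * c" .
next
  assume "smap G x \<notin> smap G ` B"
  then have "gmult G (ginv G a) x \<notin> B" if "a \<in> arrows G" "rmap G a = rmap G x" for a
    using that x by (metis image_eqI inv_closed mult_arrow(3) s_inv)
  then show "convolution G f (\<lambda>x. c * indicator B x) x = 0"
    by (auto simp: convolution_def intro!: sum.neutral)
qed

text \<open>By additivity in \<open>f\<close> it suffices to treat a scaled slice, where the product
  is a translate of \<open>g\<close>: its support lies in a compact set of products, and division by
  the slice is continuous.\<close>

lemma steinberg_convolution:
  assumes f: "f \<in> steinberg G" and g: "g \<in> steinberg G"
  shows "convolution G f g \<in> steinberg G"
  using f
proof (induction rule: steinberg_induct[where Q = "\<lambda>_. True"])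
  case zero
  then show ?case by (simp add: convolution_zero_left steinberg_zero)
next
  case (add f f')
  then show ?case by (simp add: convolution_add_left steinberg_add)
next
  case (slice c B)
  let ?h = "convolution G (\<lambda>x. c * indicator B x) g"
  show ?case
  proof (rule steinbergI)
    show "compactin (gtop G) {gmult G a y | a y. a \<in> B \<and> y \<in> supp g \<and> smap G a = rmap G y}"
      using slice g by (intro compact_products) (auto simp: slice_def steinberg_supp)
    show "supp ?h \<subseteq> {gmult G a y | a y. a \<in> B \<and> y \<in> supp g \<and> smap G a = rmap G y}"
    proof
      fix x assume "x \<in> supp ?h"
      then have "?h x \<noteq> 0"
        by (simp add: supp_def)
      then obtain b y where "c * indicator B b \<noteq> 0" "g y \<noteq> 0" "smap G b = rmap G y" "x = gmult G b y"
        by (rule convolution_nonzero)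
      moreover have "b \<in> B"
        using calculation(1) by (cases "b \<in> B") simp_all
      ultimately show "x \<in> {gmult G a y | a y. a \<in> B \<and> y \<in> supp g \<and> smap G a = rmap G y}"
        by (auto simp: supp_def)
    qed
    show "locally_constant (gtop G) ?h"
      unfolding locally_constant_def
    proof
      fix x assume x: "x \<in> arrows G"
      show "\<exists>W. openin (gtop G) W \<and> x \<in> W \<and> (\<forall>y\<in>W. ?h y = ?h x)"
      proof (cases "rmap G x \<in> rmap G ` B")
        case False
        \<comment> \<open>The range of the compact slice is closed, so the product vanishes on a
          whole neighbourhood of \<open>x\<close>.\<close>
        let ?W = "{y \<in> arrows G. rmap G y \<in> arrows G - rmap G ` B}"
        have "closedin (gtop G) (rmap G ` B)"
          using slice hausdorff image_compactin[OF _ continuous_r]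
          by (auto simp: slice_def intro: compactin_imp_closedin)
        then have "openin (gtop G) ?W"
          by (intro open_r_preimage) auto
        then show ?thesis
          using False x r_closed by (intro exI[of _ ?W]) (auto simp: convolution_slice_left(2)[OF slice(1)])
      next
        case True
        then obtain b where b: "b \<in> B" "rmap G b = rmap G x" by auto
        have bG: "b \<in> arrows G"
          using slice_arrows[OF slice(1) b(1)] .
        have "gmult G (ginv G b) x \<in> arrows G"
          using b bG x by (simp add: mult_arrow inv_closed s_inv)
        then obtain W where W: "openin (gtop G) W" "gmult G (ginv G b) x \<in> W"
            "\<forall>y\<in>W. g y = g (gmult G (ginv G b) x)"
          using g locally_constantE[of "gtop G" g] unfolding steinberg_def by blast
        obtain A N where AN: "openin (gtop G) A" "openin (gtop G) N" "b \<in> A" "x \<in> N"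
            "\<And>a y. \<lbrakk>a \<in> A; y \<in> N; rmap G a = rmap G y\<rbrakk> \<Longrightarrow> gmult G (ginv G a) y \<in> W"
          using continuous_division[OF W(1) bG x b(2) W(2)] by metis
        \<comment> \<open>The second factor ensures that an arrow of \<open>B\<close> with the range
          of \<open>y\<close> can be found inside \<open>A\<close>, so that dividing
          \<open>y\<close> by it lands in \<open>W\<close>, where \<open>g\<close> is
          constant.\<close>
        let ?V = "N \<inter> {y \<in> arrows G. rmap G y \<in> rmap G ` (A \<inter> B)}"
        have "openin (gtop G) ?V"
          using AN slice by (intro openin_Int open_r_preimage open_r_image) (auto simp: slice_def)
        moreover have "x \<in> ?V"
          using AN(3,4) b x imageI[of b "A \<inter> B" "rmap G"] by simp
        moreover have "?h y = ?h x" if y: "y \<in> ?V" for y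
        proof -
          obtain a where a: "a \<in> A" "a \<in> B" "rmap G y = rmap G a"
            using y by auto
          then have "?h y = c * g (gmult G (ginv G a) y)"
            using y slice by (intro convolution_slice_left) auto
          also have "\<dots> = c * g (gmult G (ginv G b) x)"
            using W(3) AN(5)[of a y] a y by auto
          also have "\<dots> = ?h x"
            by (rule convolution_slice_left(1)[OF slice(1) x b, symmetric])
          finally show ?thesis .
        qed
        ultimately show ?thesis by blast
      qed
    qed
  qed
qed (use openin_topspace steinberg_supp(5)[OF f] in auto)

end

section \<open>Ideals of open invariant sets\<close>

abbreviation compact_open_units :: "'g tgroupoid \<Rightarrow> 'g set \<Rightarrow> bool" where
  "compact_open_units G K \<equiv> openin (unit_top G) K \<and> compactin (unit_top G) K"

text \<open>The candidate preimage of \<open>I\<close> under \<open>ideal_of\<close>.\<close>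

definition unit_support :: "'g tgroupoid \<Rightarrow> ('g \<Rightarrow> 'r::comm_ring_1) set \<Rightarrow> 'g set" where
  "unit_support G I = \<Union>{K. compact_open_units G K \<and> indicator K \<in> I}"

lemma ideal_sumI: "\<lbrakk>f \<in> I; g \<in> J\<rbrakk> \<Longrightarrow> (\<lambda>x. f x + g x) \<in> ideal_sum I J"
  unfolding ideal_sum_def mem_Collect_eq by (rule exI[of _ f], rule exI[of _ g]) simp

lemma ideal_sumE:
  assumes "h \<in> ideal_sum I J"
  obtains f g where "f \<in> I" "g \<in> J" "h = (\<lambda>x. f x + g x)"
  using assms unfolding ideal_sum_def mem_Collect_eq by (elim exE conjE)

lemma scaled_indicator_nonzero: "c * indicator B x \<noteq> (0::'r::comm_ring_1) \<longleftrightarrow> c \<noteq> 0 \<and> x \<in> B"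
  by (cases "x \<in> B") simp_all

lemma steinberg_idealD:
  assumes "steinberg_ideal G I"
  shows "f \<in> I \<Longrightarrow> f \<in> steinberg G"
    and "(\<lambda>x. 0) \<in> I"
    and "\<lbrakk>f \<in> I; g \<in> I\<rbrakk> \<Longrightarrow> (\<lambda>x. f x + g x) \<in> I"
    and "f \<in> I \<Longrightarrow> (\<lambda>x. - f x) \<in> I"
    and "\<lbrakk>f \<in> I; a \<in> steinberg G\<rbrakk> \<Longrightarrow> convolution G a f \<in> I"
    and "\<lbrakk>f \<in> I; a \<in> steinberg G\<rbrakk> \<Longrightarrow> convolution G f a \<in> I"
  using assms unfolding steinberg_ideal_def by blast+

context hausdorff_ample_groupoid
begin

lemma compact_open_units_slice: "compact_open_units G K \<Longrightarrow> slice G K"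
  by (simp add: unit_set_slice)

lemma compact_open_units_subset: "compact_open_units G K \<Longrightarrow> x \<in> K \<Longrightarrow> x \<in> units G"
  by (auto simp: openin_unit_top)

lemma unit_basis:
  assumes "openin (gtop G) W" "x \<in> W" "x \<in> units G"
  obtains K where "compact_open_units G K" "x \<in> K" "K \<subseteq> W"
proof -
  obtain K where "slice G K" "x \<in> K" "K \<subseteq> W \<inter> units G"
    using slice_basis[of "W \<inter> units G" x] assms open_units by auto
  then show thesis
    using that by (auto simp: openin_unit_top compactin_unit_top slice_def)
qed

lemma convolution_units_left:
  assumes "compact_open_units G K"
  shows "convolution G (indicator K) f x = (if x \<in> arrows G \<and> rmap G x \<in> K then f x else 0)"
proof (cases "x \<in> arrows G")
  case x: True
  have K: "slice G K" "K \<subseteq> units G"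
    using assms by (auto simp: compact_open_units_slice openin_unit_top)
  show ?thesis
  proof (cases "rmap G x \<in> K")
    case True
    then show ?thesis
      using convolution_slice_left(1)[OF K(1) x, of "rmap G x" 1 f] x
      by (simp add: r_r inv_unit r_in_units left_unit)
  next
    case False
    moreover have "rmap G ` K = K"
      using K r_unit by force
    ultimately show ?thesis
      using convolution_slice_left(2)[OF K(1) x, of 1 f] by simp
  qed
qed (simp add: convolution_def)

lemma convolution_units_right:
  assumes "compact_open_units G K" "f \<in> steinberg G"
  shows "convolution G f (indicator K) x = (if x \<in> arrows G \<and> smap G x \<in> K then f x else 0)"
proof (cases "x \<in> arrows G")
  case x: True
  have K: "slice G K" "K \<subseteq> units G"
    using assms by (auto simp: compact_open_units_slice openin_unit_top)
  show ?thesis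
  proof (cases "smap G x \<in> K")
    case True
    then show ?thesis
      using convolution_slice_right(1)[OF assms(2) K(1) x, of "smap G x" 1] x
      by (simp add: s_s inv_unit s_in_units right_unit)
  next
    case False
    moreover have "smap G ` K = K"
      using K s_unit by force
    ultimately show ?thesis
      using convolution_slice_right(2)[OF assms(2) K(1) x, of 1] by simp
  qed
qed (simp add: convolution_def)

lemma slice_mult_units:
  assumes "slice G B" "compact_open_units G K" "smap G ` B \<subseteq> K"
  shows "convolution G (\<lambda>x. c * indicator B x) (indicator K) = (\<lambda>x. c * indicator B x)"
proof
  fix x
  show "convolution G (\<lambda>x. c * indicator B x) (indicator K) x = c * indicator B x"
    using assms slice_arrows[OF assms(1)]
    by (cases "x \<in> B") (auto simp: convolution_units_right steinberg_slice)
qed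

text \<open>The function form of multiplying a slice by its inverse, which yields its range. It
  transports membership in an ideal from sources to ranges.\<close>

lemma slice_mult_inv:
  assumes B: "slice G B"
  shows "convolution G (indicator B) (indicator (ginv G ` B)) = (indicator (rmap G ` B) :: 'a \<Rightarrow> 'r::comm_ring_1)"
proof
  fix x
  show "convolution G (indicator B) (indicator (ginv G ` B)) x = (indicator (rmap G ` B) x :: 'r)"
  proof (cases "x \<in> arrows G \<and> rmap G x \<in> rmap G ` B")
    case True
    then obtain b where b: "b \<in> B" "rmap G b = rmap G x" and x: "x \<in> arrows G" by auto
    have bG: "b \<in> arrows G"
      using slice_arrows[OF B b(1)] .
    \<comment> \<open>The left side decides the value of the product at \<open>x\<close>. If the
      quotient is the inverse of some \<open>d\<close> in \<open>B\<close>, then \<open>d\<close>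
      and \<open>b\<close> share their source, so \<open>d = b\<close> and \<open>x\<close> is the
      unit \<open>rmap G b\<close>.\<close>
    have "gmult G (ginv G b) x \<in> ginv G ` B \<longleftrightarrow> x \<in> rmap G ` B"
    proof
      assume "gmult G (ginv G b) x \<in> ginv G ` B"
      then obtain d where d: "d \<in> B" "gmult G (ginv G b) x = ginv G d" by auto
      have dG: "d \<in> arrows G"
        using slice_arrows[OF B d(1)] .
      have "rmap G (gmult G (ginv G b) x) = smap G b"
        using b bG x by (simp add: mult_arrow inv_closed s_inv r_inv)
      then have "smap G d = smap G b"
        using d(2) dG by (simp add: r_inv)
      then have "d = b"
        using B b d by (auto simp: slice_def inj_on_def)
      then have "x = gmult G b (ginv G b)"
        using mult_inv_cancel[OF bG x b(2)] d(2) by simp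
      then show "x \<in> rmap G ` B"
        using b(1) bG by (simp add: right_inv)
    next
      assume "x \<in> rmap G ` B"
      then have "rmap G x = x"
        using slice_arrows[OF B] r_r by auto
      then have "gmult G (ginv G b) x = ginv G b"
        using b right_unit[OF inv_closed[OF bG]] s_inv[OF bG] by simp
      then show "gmult G (ginv G b) x \<in> ginv G ` B"
        using b by simp
    qed
    then have "indicator (ginv G ` B) (gmult G (ginv G b) x) = (indicator (rmap G ` B) x :: 'r)"
      by (metis indicator_eq_0_iff indicator_eq_1_iff)
    then show ?thesis
      using convolution_slice_left(1)[OF B x b, of "1::'r" "indicator (ginv G ` B)"] by simp
  next
    case False
    then have "x \<notin> rmap G ` B"
      using slice_arrows[OF B] r_closed r_r by force
    then show ?thesis
      using False convolution_slice_left(2)[OF B, of x "1::'r" "indicator (ginv G ` B)"]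
      by (cases "x \<in> arrows G") (auto simp: convolution_def)
  qed
qed

lemma ideal_of_iff: "f \<in> ideal_of G U \<longleftrightarrow> f \<in> steinberg G \<and> (\<forall>x. f x \<noteq> 0 \<longrightarrow> smap G x \<in> U)"
  using steinberg_supp(5)[of f] by (auto simp: ideal_of_def supp_def reduction_arrows_def)

lemma scaled_indicator_ideal_of:
  assumes "compact_open_units G K" "c \<noteq> 0"
  shows "(\<lambda>x. c * indicator K x) \<in> ideal_of G U \<longleftrightarrow> K \<subseteq> U"
  using assms compact_open_units_subset[OF assms(1)]
  by (auto simp: ideal_of_iff steinberg_slice compact_open_units_slice scaled_indicator_nonzero s_unit)

lemma indicator_ideal_of:
  assumes "compact_open_units G K"
  shows "(indicator K :: _ \<Rightarrow> 'r::comm_ring_1) \<in> ideal_of G U \<longleftrightarrow> K \<subseteq> U"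
  using scaled_indicator_ideal_of[OF assms, of "1::'r"] by simp

lemma ideal_of_add:
  assumes f: "f \<in> ideal_of G U" and g: "g \<in> ideal_of G U"
  shows "(\<lambda>x. f x + g x) \<in> ideal_of G U"
proof -
  have "smap G x \<in> U" if "f x + g x \<noteq> 0" for x
  proof -
    have "f x \<noteq> 0 \<or> g x \<noteq> 0"
      using that by auto
    then show ?thesis
      using f g unfolding ideal_of_iff by blast
  qed
  then show ?thesis
    using f g steinberg_add[of f g] by (simp add: ideal_of_iff)
qed

lemma ideal_of_mono: "U \<subseteq> V \<Longrightarrow> ideal_of G U \<subseteq> ideal_of G V"
  unfolding ideal_of_def reduction_arrows_def by blast

text \<open>A product has the source of its right factor, which settles multiplication from the
  left. From the right, composability puts the range of the second factor in \<open>U\<close>, and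
  invariance moves this to its source.\<close>

lemma ideal_of_ideal:
  assumes U: "invariant G U"
  shows "steinberg_ideal G (ideal_of G U :: ('a \<Rightarrow> 'r::comm_ring_1) set)"
proof -
  have conv: "convolution G a f \<in> ideal_of G U \<and> convolution G f a \<in> ideal_of G U"
    if f: "f \<in> ideal_of G U" and a: "a \<in> steinberg G" for a f :: "'a \<Rightarrow> 'r"
  proof -
    have fs: "f \<in> steinberg G" and fU: "\<And>x. f x \<noteq> 0 \<Longrightarrow> smap G x \<in> U"
      using f by (simp_all add: ideal_of_iff)
    have "smap G x \<in> U" if "convolution G a f x \<noteq> 0" for x
      using that by (rule convolution_nonzero) (simp add: mult_arrow fU)
    moreover have "smap G x \<in> U" if "convolution G f a x \<noteq> 0" for x
      using that
    proof (rule convolution_nonzero)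
      fix b y assume *: "b \<in> arrows G" "y \<in> arrows G" "f b \<noteq> 0" "smap G b = rmap G y" "x = gmult G b y"
      then have "rmap G y \<in> U"
        using fU by metis
      then show "smap G x \<in> U"
        using * invariant_iff[OF U] by (simp add: mult_arrow)
    qed
    ultimately show ?thesis
      using fs a by (simp add: ideal_of_iff steinberg_convolution)
  qed
  have sub: "ideal_of G U \<subseteq> (steinberg G :: ('a \<Rightarrow> 'r) set)"
    by (auto simp: ideal_of_def)
  have zero: "(\<lambda>x. 0 :: 'r) \<in> ideal_of G U"
    by (simp add: ideal_of_iff steinberg_zero)
  have neg: "(\<lambda>x. - f x) \<in> ideal_of G U" if "f \<in> ideal_of G U" for f :: "'a \<Rightarrow> 'r"
    using that steinberg_uminus[of f] by (simp add: ideal_of_iff)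
  show ?thesis
    unfolding steinberg_ideal_def
    by (intro conjI ballI sub zero ideal_of_add neg conv[THEN conjunct1] conv[THEN conjunct2])
qed

text \<open>Whether \<open>c * indicator K x\<close> belongs to the ideal is decided by
  \<open>K \<subseteq> U\<close> alone, for every nonzero \<open>c\<close>.\<close>

lemma ideal_of_basic:
  assumes "invariant G U"
  shows "basic_ideal G (ideal_of G U :: ('a \<Rightarrow> 'r::comm_ring_1) set)"
  using ideal_of_ideal[OF assms] indicator_ideal_of scaled_indicator_ideal_of
  unfolding basic_ideal_def by blast

lemma ideal_of_mono_iff:
  assumes "openin (unit_top G) U"
  shows "ideal_of G U \<subseteq> (ideal_of G V :: ('a \<Rightarrow> 'r::comm_ring_1) set) \<longleftrightarrow> U \<subseteq> V"
proof
  assume sub: "ideal_of G U \<subseteq> (ideal_of G V :: ('a \<Rightarrow> 'r) set)"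
  show "U \<subseteq> V"
  proof
    fix x assume "x \<in> U"
    then obtain K where K: "compact_open_units G K" "x \<in> K" "K \<subseteq> U"
      using assms unit_basis[of U x] by (auto simp: openin_unit_top)
    then show "x \<in> V"
      using sub indicator_ideal_of[OF K(1), where 'r='r] by blast
  qed
qed (rule ideal_of_mono)

text \<open>Slices can be chosen so small that the sources of each lie entirely in \<open>U\<close>
  or entirely in \<open>V\<close>; each piece then belongs to one of the two summands.\<close>

lemma ideal_of_Un:
  assumes "openin (unit_top G) U" "openin (unit_top G) V"
  shows "ideal_of G (U \<union> V) = ideal_sum (ideal_of G U) (ideal_of G V :: ('a \<Rightarrow> 'r::comm_ring_1) set)"
    (is "_ = ?S")
proof
  have zeros: "(\<lambda>x. 0 :: 'r) \<in> ideal_of G U" "(\<lambda>x. 0 :: 'r) \<in> ideal_of G V"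
    by (simp_all add: ideal_of_iff steinberg_zero)
  show "ideal_of G (U \<union> V) \<subseteq> ?S"
  proof
    fix f :: "'a \<Rightarrow> 'r" assume f: "f \<in> ideal_of G (U \<union> V)"
    then have "f \<in> steinberg G"
      by (simp add: ideal_of_iff)
    then show "f \<in> ?S"
    proof (induction rule: steinberg_induct[where Q = "\<lambda>B. smap G ` B \<subseteq> U \<or> smap G ` B \<subseteq> V"])
      case (small x)
      then have "x \<in> arrows G" "smap G x \<in> U \<or> smap G x \<in> V"
        using f steinberg_supp(5)[of f x] by (auto simp: ideal_of_iff)
      moreover have "openin (gtop G) {y \<in> arrows G. smap G y \<in> U}"
        "openin (gtop G) {y \<in> arrows G. smap G y \<in> V}"
        using assms by (auto intro: open_s_preimage simp: openin_unit_top)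
      ultimately show ?case by blast
    next
      case zero
      then show ?case
        using ideal_sumI[OF zeros] by simp
    next
      case (add f g)
      then obtain f1 f2 g1 g2 where fg: "f1 \<in> ideal_of G U" "f2 \<in> ideal_of G V" "f = (\<lambda>x. f1 x + f2 x)"
        "g1 \<in> ideal_of G U" "g2 \<in> ideal_of G V" "g = (\<lambda>x. g1 x + g2 x)"
        by (elim ideal_sumE)
      have "(\<lambda>x. (f1 x + g1 x) + (f2 x + g2 x)) \<in> ?S"
        using fg by (intro ideal_sumI ideal_of_add)
      then show ?case
        unfolding fg(3,6) by (simp add: algebra_simps)
    next
      case (slice c B)
      let ?h = "\<lambda>x. c * indicator B x"
      have "?h \<in> ideal_of G U \<or> ?h \<in> ideal_of G V"
        using slice by (auto simp: ideal_of_iff steinberg_slice scaled_indicator_nonzero)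
      then have "(\<lambda>x. ?h x + 0) \<in> ?S \<or> (\<lambda>x. 0 + ?h x) \<in> ?S"
        using ideal_sumI[OF _ zeros(2)] ideal_sumI[OF zeros(1)] by blast
      then show ?case by simp
    qed blast
  qed
  show "?S \<subseteq> ideal_of G (U \<union> V)"
    using ideal_of_mono[of U "U \<union> V"] ideal_of_mono[of V "U \<union> V"]
    by (auto elim!: ideal_sumE intro!: ideal_of_add)
qed

text \<open>Small slices have all their sources in one \<open>K\<close> with
  \<open>indicator K \<in> I\<close>, and multiplying such a slice by \<open>indicator K\<close> on
  the right does not change it.\<close>

lemma ideal_of_unit_support_subset:
  assumes I: "steinberg_ideal G (I :: ('a \<Rightarrow> 'r::comm_ring_1) set)"
  shows "ideal_of G (unit_support G I) \<subseteq> I"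
proof
  fix f :: "'a \<Rightarrow> 'r" assume f: "f \<in> ideal_of G (unit_support G I)"
  then have fs: "f \<in> steinberg G"
    by (simp add: ideal_of_iff)
  then show "f \<in> I"
  proof (induction rule: steinberg_induct
      [where Q = "\<lambda>B. \<exists>K. compact_open_units G K \<and> indicator K \<in> I \<and> smap G ` B \<subseteq> K"])
    case (small x)
    then have "x \<in> arrows G" "smap G x \<in> unit_support G I"
      using f fs steinberg_supp(5) by (auto simp: ideal_of_iff)
    then obtain K where K: "compact_open_units G K" "indicator K \<in> I" "smap G x \<in> K"
      unfolding unit_support_def by blast
    let ?W = "{y \<in> arrows G. smap G y \<in> K}"
    have "openin (gtop G) ?W" "x \<in> ?W" "smap G ` ?W \<subseteq> K"
      using K \<open>x \<in> arrows G\<close> by (auto intro: open_s_preimage simp: openin_unit_top)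
    then show ?case
      using K by blast
  next
    case (slice c B)
    then obtain K where K: "compact_open_units G K" "indicator K \<in> I" "smap G ` B \<subseteq> K"
      by blast
    show ?case
      using steinberg_idealD(5)[OF I K(2) steinberg_slice[OF slice(1)], of c]
        slice_mult_units[OF slice(1) K(1,3), of c] by simp
  next
    case zero
    show ?case
      using I by (rule steinberg_idealD(2))
  next
    case (add f g)
    then show ?case
      by (intro steinberg_idealD(3)[OF I])
  qed blast
qed

lemma unit_support_open: "openin (unit_top G) (unit_support G I)"
  unfolding unit_support_def by (intro openin_Union) auto

text \<open>For a slice \<open>B\<close> around \<open>x\<close> with sources in \<open>K\<close>,
  the indicator of \<open>B\<close> is a left multiple of that of \<open>K\<close>, hence in
  \<open>I\<close>. Multiplying by the inverse slice puts the indicator of \<open>rmap G\<close>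
  applied to \<open>B\<close> into \<open>I\<close>.\<close>

lemma unit_support_invariant:
  assumes I: "steinberg_ideal G (I :: ('a \<Rightarrow> 'r::comm_ring_1) set)"
  shows "invariant G (unit_support G I)"
  unfolding invariant_def
proof (intro conjI ballI impI)
  show "unit_support G I \<subseteq> units G"
    using unit_support_open[of I] by (simp add: openin_unit_top)
  fix x assume x: "x \<in> arrows G" "smap G x \<in> unit_support G I"
  then obtain K where K: "compact_open_units G K" "indicator K \<in> I" "smap G x \<in> K"
    unfolding unit_support_def by blast
  have "openin (gtop G) {y \<in> arrows G. smap G y \<in> K}"
    using K by (auto intro: open_s_preimage simp: openin_unit_top)
  then obtain B where B: "slice G B" "x \<in> B" "B \<subseteq> {y \<in> arrows G. smap G y \<in> K}"
    using slice_basis x K(3) by (metis (mono_tags, lifting) mem_Collect_eq)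
  have "convolution G (indicator B) (indicator K) \<in> I"
    using steinberg_idealD(5)[OF I K(2) steinberg_indicator[OF B(1)]] .
  moreover have "smap G ` B \<subseteq> K"
    using B(3) by auto
  ultimately have "indicator B \<in> I"
    using slice_mult_units[OF B(1) K(1), of "1::'r"] by simp
  then have "indicator (rmap G ` B) \<in> I"
    using steinberg_idealD(6)[OF I _ steinberg_indicator[OF slice_inv[OF B(1)]]] slice_mult_inv[OF B(1)]
    by metis
  moreover have "rmap G ` B = smap G ` ginv G ` B"
    using slice_arrows[OF B(1)] s_inv by force
  then have "compact_open_units G (rmap G ` B)"
    using slice_s_image[OF slice_inv[OF B(1)]] by simp
  ultimately show "rmap G x \<in> unit_support G I"
    using B(2) unfolding unit_support_def by blast
qed

end

section \<open>Basic ideals over strongly effective groupoids\<close>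

context hausdorff_ample_groupoid
begin

text \<open>Effectiveness restated inside \<open>G\<close>. The units of the reduction are
  \<open>V\<close>, which is relatively open and consists of isotropy, so only the other inclusion
  has content: no non-unit over \<open>V\<close> is interior to the isotropy over
  \<open>V\<close>.\<close>

lemma effective_reduction_iff:
  assumes V: "invariant G V"
  shows "effective (reduction G V) \<longleftrightarrow>
    (\<forall>W x. openin (gtop G) W \<and> x \<in> W \<and> smap G x \<in> V \<and> x \<notin> units G
      \<longrightarrow> (\<exists>y\<in>W. smap G y \<in> V \<and> rmap G y \<noteq> smap G y))"
proof -
  let ?A = "reduction_arrows G V"
  let ?T = "subtopology (gtop G) ?A"
  have VX: "V \<subseteq> units G"
    using V by (simp add: invariant_def)
  have A: "?A \<subseteq> arrows G" "topspace ?T = ?A"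
    by (auto simp: reduction_arrows_def)
  have "rmap G ` ?A = V"
  proof
    show "rmap G ` ?A \<subseteq> V"
      using V by (auto simp: reduction_arrows_def invariant_def)
    show "V \<subseteq> rmap G ` ?A"
    proof
      fix v assume v: "v \<in> V"
      then have "v \<in> ?A" "rmap G v = v"
        using VX s_unit r_unit unit_arrow by (auto simp: reduction_arrows_def)
      then show "v \<in> rmap G ` ?A"
        by (metis imageI)
    qed
  qed
  then have un: "units (reduction G V) = V"
    using A by (simp add: units_def reduction_def)
  let ?I = "{x \<in> ?A. rmap G x = smap G x}"
  have iso: "Iso (reduction G V) = ?I"
    using A by (simp add: Iso_def reduction_def)
  have eff: "effective (reduction G V) \<longleftrightarrow> ?T interior_of ?I = V"
    unfolding effective_def un iso by (simp add: reduction_def)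
  have "V = ?A \<inter> units G"
    using VX s_unit unit_arrow by (auto simp: reduction_arrows_def)
  then have "openin ?T V"
    using open_units by (metis openin_subtopology_Int2)
  moreover have "V \<subseteq> ?I"
    using VX s_unit r_unit unit_arrow by (auto simp: reduction_arrows_def)
  ultimately have sub: "V \<subseteq> ?T interior_of ?I"
    by (simp add: interior_of_maximal)
  show ?thesis
  proof
    assume "effective (reduction G V)"
    then have int: "?T interior_of ?I = V"
      using eff by simp
    show "\<forall>W x. openin (gtop G) W \<and> x \<in> W \<and> smap G x \<in> V \<and> x \<notin> units G
      \<longrightarrow> (\<exists>y\<in>W. smap G y \<in> V \<and> rmap G y \<noteq> smap G y)"
    proof (intro allI impI, rule ccontr)
      fix W x
      assume W: "openin (gtop G) W \<and> x \<in> W \<and> smap G x \<in> V \<and> x \<notin> units G"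
        and none: "\<not> (\<exists>y\<in>W. smap G y \<in> V \<and> rmap G y \<noteq> smap G y)"
      have "?A \<inter> W \<subseteq> ?I"
        using none by (auto simp: reduction_arrows_def)
      moreover have "openin ?T (?A \<inter> W)"
        using W by (simp add: openin_subtopology_Int2)
      ultimately have "?A \<inter> W \<subseteq> ?T interior_of ?I"
        by (rule interior_of_maximal)
      moreover have "x \<in> ?A \<inter> W"
        using W openin_subset by (auto simp: reduction_arrows_def)
      ultimately have "x \<in> V"
        using int by blast
      then show False
        using W VX by blast
    qed
  next
    assume *: "\<forall>W x. openin (gtop G) W \<and> x \<in> W \<and> smap G x \<in> V \<and> x \<notin> units G
      \<longrightarrow> (\<exists>y\<in>W. smap G y \<in> V \<and> rmap G y \<noteq> smap G y)"
    have "?T interior_of ?I \<subseteq> V"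
    proof
      fix x assume x: "x \<in> ?T interior_of ?I"
      then have xA: "x \<in> ?A"
        using interior_of_subset by fastforce
      obtain S where S: "openin ?T S" "x \<in> S" "S \<subseteq> ?I"
        using x by (auto simp: interior_of_def)
      then obtain W where W: "openin (gtop G) W" "S = W \<inter> ?A"
        by (auto simp: openin_subtopology)
      have "rmap G y = smap G y" if "y \<in> W" "smap G y \<in> V" for y
      proof -
        have "y \<in> S"
          using that W openin_subset[OF W(1)] by (auto simp: reduction_arrows_def)
        then show ?thesis
          using S(3) by blast
      qed
      then have "x \<in> units G"
        using * W S(2) xA by (metis (mono_tags, lifting) IntE mem_Collect_eq reduction_arrows_def)
      then show "x \<in> V"
        using xA s_unit by (simp add: reduction_arrows_def)
    qed
    then show "effective (reduction G V)"
      using eff sub by blast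
  qed
qed

text \<open>Effectiveness supplies \<open>z \<in> B\<close> over \<open>Q \<inter> V\<close> with
  distinct range and source. After separating these by \<open>M\<close> and \<open>N\<close>,
  \<open>Q'\<close> is the set of sources of the arrows of \<open>B\<close> near \<open>z\<close>:
  injectivity of the source map sends every arrow of \<open>B\<close> starting in \<open>Q'\<close>
  into \<open>N\<close>, away from \<open>Q'\<close>.\<close>

lemma shrink_off_slice:
  assumes V: "invariant G V" "effective (reduction G V)"
    and B: "slice G B" "B \<inter> units G = {}"
    and Q: "openin (gtop G) Q" "Q \<inter> V \<noteq> {}"
  obtains Q' where "openin (gtop G) Q'" "Q' \<subseteq> Q" "Q' \<inter> V \<noteq> {}"
    "\<And>y. \<lbrakk>y \<in> B; smap G y \<in> Q' \<inter> V\<rbrakk> \<Longrightarrow> rmap G y \<notin> Q'"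
proof (cases "\<exists>x\<in>B. smap G x \<in> Q \<inter> V")
  \<comment> \<open>No arrow of \<open>B\<close> starts in \<open>Q \<inter> V\<close>, so
    \<open>Q\<close> itself works vacuously.\<close>
  case False
  then show ?thesis
    using Q that[of Q] by blast
next
  case True
  then obtain x where x: "x \<in> B" "smap G x \<in> Q" "smap G x \<in> V" by auto
  have oB: "openin (gtop G) B"
    using B by (simp add: slice_def)
  have "openin (gtop G) (B \<inter> {y \<in> arrows G. smap G y \<in> Q})"
    using oB Q open_s_preimage by blast
  moreover have "x \<in> B \<inter> {y \<in> arrows G. smap G y \<in> Q}"
    using x slice_arrows[OF B(1)] by auto
  moreover have "x \<notin> units G"
    using x B by auto
  ultimately obtain z where z: "z \<in> B" "z \<in> arrows G" "smap G z \<in> Q" "smap G z \<in> V" "rmap G z \<noteq> smap G z"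
    using V(2) x(3) unfolding effective_reduction_iff[OF V(1)] by blast
  obtain M N where MN: "openin (gtop G) M" "openin (gtop G) N" "smap G z \<in> M" "rmap G z \<in> N" "disjnt M N"
    using hausdorff z unfolding Hausdorff_space_def by (metis r_closed s_closed)
  let ?C = "B \<inter> {y \<in> arrows G. smap G y \<in> Q \<inter> M} \<inter> {y \<in> arrows G. rmap G y \<in> N}"
  have "openin (gtop G) ?C"
    using oB Q MN by (intro openin_Int open_s_preimage open_r_preimage)
  then have "openin (gtop G) (smap G ` ?C)"
    by (rule open_s_image)
  moreover have "smap G ` ?C \<subseteq> Q" "smap G ` ?C \<subseteq> M"
    by auto
  moreover have "smap G z \<in> smap G ` ?C"
    using z MN by blast
  moreover have "rmap G y \<notin> smap G ` ?C" if y: "y \<in> B" "smap G y \<in> smap G ` ?C" for y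
  proof -
    have "y \<in> ?C"
      using y B(1) by (auto simp: slice_def dest: inj_onD)
    then show ?thesis
      using \<open>smap G ` ?C \<subseteq> M\<close> MN(5) by (auto simp: disjnt_iff)
  qed
  ultimately show ?thesis
    using that[of "smap G ` ?C"] z(4) by blast
qed

text \<open>The slices are treated one after another; what was achieved for earlier ones is
  inherited by smaller open sets.\<close>

lemma shrink_off_slices:
  assumes V: "invariant G V" "effective (reduction G V)"
    and "finite F" "\<And>B. B \<in> F \<Longrightarrow> slice G B \<and> B \<inter> units G = {}"
    and Q: "openin (gtop G) Q" "Q \<inter> V \<noteq> {}"
  shows "\<exists>Q'. openin (gtop G) Q' \<and> Q' \<subseteq> Q \<and> Q' \<inter> V \<noteq> {} \<and>
    (\<forall>B\<in>F. \<forall>y\<in>B. smap G y \<in> Q' \<inter> V \<longrightarrow> rmap G y \<notin> Q')"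
  using assms(3,4)
proof (induction F)
  case empty
  then show ?case using Q by blast
next
  case (insert B F)
  then obtain Q1 where Q1: "openin (gtop G) Q1" "Q1 \<subseteq> Q" "Q1 \<inter> V \<noteq> {}"
    "\<forall>B\<in>F. \<forall>y\<in>B. smap G y \<in> Q1 \<inter> V \<longrightarrow> rmap G y \<notin> Q1"
    by auto
  have "slice G B" "B \<inter> units G = {}"
    using insert.prems by auto
  then obtain Q2 where "openin (gtop G) Q2" "Q2 \<subseteq> Q1" "Q2 \<inter> V \<noteq> {}"
    "\<And>y. \<lbrakk>y \<in> B; smap G y \<in> Q2 \<inter> V\<rbrakk> \<Longrightarrow> rmap G y \<notin> Q2"
    using shrink_off_slice[OF V _ _ Q1(1,3)] by metis
  then show ?case
    using Q1 by (intro exI[of _ Q2]) blast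
qed

lemma complement_closed_invariant:
  assumes "openin (unit_top G) U" "invariant G U"
  shows "closedin (unit_top G) (units G - U)" "invariant G (units G - U)"
proof -
  have "topspace (unit_top G) = units G"
    using unit_arrow by (auto simp: unit_top_def)
  then show "closedin (unit_top G) (units G - U)"
    using assms(1) by (metis openin_closedin_eq)
  show "invariant G (units G - U)"
    using invariant_iff[OF assms(2)] r_in_units by (auto simp: invariant_def)
qed

text \<open>Strong effectiveness makes a cut-down element of \<open>I\<close> agree with a multiple
  of an indicator over the complement of the unit support; basicness then removes the
  scalar.\<close>

lemma basic_ideal_subset:
  assumes eff: "strongly_effective G" and I: "basic_ideal G (I :: ('a \<Rightarrow> 'r::comm_ring_1) set)"
  shows "I \<subseteq> ideal_of G (unit_support G I)"
proof
  fix f :: "'a \<Rightarrow> 'r" assume f: "f \<in> I"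
  let ?U = "unit_support G I" and ?V = "units G - unit_support G I"
  have ideal: "steinberg_ideal G I"
    and basic: "\<And>K c. \<lbrakk>compact_open_units G K; c \<noteq> 0; (\<lambda>x. c * indicator K x) \<in> I\<rbrakk> \<Longrightarrow> indicator K \<in> I"
    using I unfolding basic_ideal_def by blast+
  have fs: "f \<in> steinberg G"
    using steinberg_idealD(1)[OF ideal f] .
  have V: "closedin (unit_top G) ?V" "invariant G ?V"
    using complement_closed_invariant[OF unit_support_open unit_support_invariant[OF ideal]] .
  show "f \<in> ideal_of G ?U"
    unfolding ideal_of_iff
  proof (intro conjI allI impI fs, rule ccontr)
    fix \<gamma> assume \<gamma>: "f \<gamma> \<noteq> 0" "smap G \<gamma> \<notin> ?U"
    have \<gamma>G: "\<gamma> \<in> arrows G"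
      using steinberg_supp(5)[OF fs \<gamma>(1)] .
    let ?v = "smap G \<gamma>"
    have v: "?v \<in> ?V" "?v \<in> arrows G" "rmap G ?v = ?v"
      using \<gamma>(2) \<gamma>G by (simp_all add: s_in_units s_closed r_s)
    have effV: "effective (reduction G ?V)"
      using eff[unfolded strongly_effective_def, rule_format, of ?V] V v(1) by fast
    obtain B where B: "slice G B" "\<gamma> \<in> B"
      using openin_topspace \<gamma>G by (rule slice_basis)
    \<comment> \<open>Translating by a slice moves \<open>\<gamma>\<close> to the unit \<open>s \<gamma>\<close>.\<close>
    define g where "g = convolution G (indicator (ginv G ` B)) f"
    have gI: "g \<in> I"
      unfolding g_def using steinberg_idealD(5)[OF ideal f] steinberg_indicator slice_inv B(1) by blast
    have gs: "g \<in> steinberg G"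
      using steinberg_idealD(1)[OF ideal gI] .
    define c where "c = g ?v"
    have "g ?v = f (gmult G (ginv G (ginv G \<gamma>)) ?v)"
      using convolution_slice_left(1)[OF slice_inv[OF B(1)] v(2), of "ginv G \<gamma>" "1::'r" f] B(2) \<gamma>G
      by (simp add: g_def r_inv r_s)
    then have "g ?v = f \<gamma>"
      using \<gamma>G by (simp add: inv_inv right_unit)
    then have c: "c \<noteq> 0"
      using \<gamma>(1) by (simp add: c_def)
    \<comment> \<open>An open set of units around \<open>?v\<close> on which \<open>g\<close> is
      constantly \<open>c\<close>; it controls the diagonal part.\<close>
    let ?D = "{x \<in> arrows G. g x = c} \<inter> units G"
    have D: "openin (gtop G) ?D" "?D \<inter> ?V \<noteq> {}"
      using gs open_units openin_locally_constant[of "gtop G" g "\<lambda>a. a = c"] v s_in_units[OF \<gamma>G]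
      by (auto simp: steinberg_def c_def)
    \<comment> \<open>The off-diagonal part of the support. The unit space is clopen, so this set is
      compact open and finitely many slices without units cover it.\<close>
    let ?N = "supp g - units G"
    have N: "openin (gtop G) ?N" "compactin (gtop G) ?N"
      using steinberg_supp[OF gs] open_units closed_units
      by (auto intro!: closed_compactin[OF steinberg_supp(1)[OF gs]])
    have "?N \<subseteq> \<Union>{B. slice G B \<and> B \<subseteq> ?N}"
    proof
      fix x assume "x \<in> ?N"
      then obtain C where "slice G C" "x \<in> C" "C \<subseteq> ?N"
        by (rule slice_basis[OF N(1)])
      then show "x \<in> \<Union>{B. slice G B \<and> B \<subseteq> ?N}"
        by blast
    qed
    then obtain F where F: "finite F" "F \<subseteq> {B. slice G B \<and> B \<subseteq> ?N}" "?N \<subseteq> \<Union>F"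
      using compactinD[OF N(2), of "{B. slice G B \<and> B \<subseteq> ?N}"] by (auto simp: slice_def)
    have "slice G B \<and> B \<inter> units G = {}" if "B \<in> F" for B
      using that F(2) by blast
    then obtain Q where Q: "openin (gtop G) Q" "Q \<subseteq> ?D" "Q \<inter> ?V \<noteq> {}"
      and QF: "\<forall>B\<in>F. \<forall>y\<in>B. smap G y \<in> Q \<inter> ?V \<longrightarrow> rmap G y \<notin> Q"
      using shrink_off_slices[OF V(2) effV F(1) _ D] by blast
    then obtain w where w: "w \<in> Q" "w \<in> ?V" by blast
    obtain L where L: "compact_open_units G L" "w \<in> L" "L \<subseteq> Q"
      using unit_basis[OF Q(1) w(1)] w(2) by blast
    define h where "h = convolution G (convolution G (indicator L) g) (indicator L)"
    have Ls: "(indicator L :: 'a \<Rightarrow> 'r) \<in> steinberg G" "slice G L"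
      using L(1) by (simp_all add: steinberg_indicator compact_open_units_slice)
    have hI: "h \<in> I"
      unfolding h_def by (intro steinberg_idealD(5,6)[OF ideal] gI Ls)
    have h: "h x = (if x \<in> arrows G \<and> rmap G x \<in> L \<and> smap G x \<in> L then g x else 0)" for x
      unfolding h_def using L(1) Ls(1) gs
      by (simp add: convolution_units_right convolution_units_left steinberg_convolution)
    \<comment> \<open>The error term. Over \<open>?V\<close> it vanishes: at units because
      \<open>L\<close> lies in \<open>?D\<close>, elsewhere because no arrow of \<open>?N\<close>
      with source in \<open>?V\<close> has both ends in \<open>Q\<close>.\<close>
    define d where "d = (\<lambda>x. h x + - (c * indicator L x))"
    have "d \<in> ideal_of G ?U"
      unfolding ideal_of_iff
    proof (intro conjI allI impI, unfold d_def)
      show "(\<lambda>x. h x + - (c * indicator L x)) \<in> steinberg G"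
        using steinberg_idealD(1)[OF ideal hI] Ls(2)
        by (intro steinberg_add steinberg_uminus steinberg_slice)
      fix x assume x: "h x + - (c * indicator L x) \<noteq> 0"
      show "smap G x \<in> ?U"
      proof (rule ccontr)
        assume sx: "smap G x \<notin> ?U"
        show False
        proof (cases "x \<in> units G")
          case True
          then have "h x = (if x \<in> L then g x else 0)"
            by (simp add: h r_unit s_unit unit_arrow)
          moreover have "g x = c" if "x \<in> L"
            using that L(3) Q(2) by blast
          ultimately show False
            using x by (cases "x \<in> L") simp_all
        next
          case False
          then have "x \<notin> L"
            using compact_open_units_subset[OF L(1)] by blast
          then have "h x \<noteq> 0"
            using x by simp
          then have *: "x \<in> arrows G" "rmap G x \<in> L" "smap G x \<in> L" "g x \<noteq> 0"
            by (auto simp: h split: if_splits)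
          then have "x \<in> ?N" "smap G x \<in> Q \<inter> ?V" "rmap G x \<in> Q"
            using False sx L(3) by (auto simp: supp_def s_in_units)
          then show False
            using QF F(3) by blast
        qed
      qed
    qed
    then have "d \<in> I"
      using ideal_of_unit_support_subset[OF ideal] by blast
    then have "(\<lambda>x. h x + - d x) \<in> I"
      using steinberg_idealD(3)[OF ideal hI] steinberg_idealD(4)[OF ideal] by blast
    moreover have "(\<lambda>x. h x + - d x) = (\<lambda>x. c * indicator L x)"
      by (simp add: d_def)
    ultimately have "indicator L \<in> I"
      using basic[OF L(1) c] by simp
    then have "w \<in> ?U"
      using L unfolding unit_support_def by blast
    then show False
      using w by blast
  qed
qed

end

section \<open>The kernel of the orbit representation\<close>

definition orbit_sum :: "'g tgroupoid \<Rightarrow> ('g \<Rightarrow> 'r::comm_ring_1) \<Rightarrow> 'g \<Rightarrow> 'g \<Rightarrow> 'r" where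
  "orbit_sum G f x y = (\<Sum>\<gamma> | \<gamma> \<in> arrows G \<and> rmap G \<gamma> = x \<and> smap G \<gamma> = y \<and> f \<gamma> \<noteq> 0. f \<gamma>)"

text \<open>
  The kernel of the action of the algebra on the free module over \<open>V\<close> in which \<open>f\<close> sends a basis
  element \<open>y\<close> to the sum of \<open>f \<gamma> \<cdot> r \<gamma>\<close> over the arrows \<open>\<gamma>\<close> with source \<open>y\<close>; \<open>orbit_sum G f\<close> is
  the matrix of \<open>f\<close>.
\<close>

definition orbit_kernel :: "'g tgroupoid \<Rightarrow> 'g set \<Rightarrow> ('g \<Rightarrow> 'r::comm_ring_1) set" where
  "orbit_kernel G V = {f \<in> steinberg G. \<forall>x\<in>V. \<forall>y\<in>V. orbit_sum G f x y = 0}"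

context hausdorff_ample_groupoid
begin

lemma orbit_sum_eq:
  assumes "finite S" "\<And>\<gamma>. \<gamma> \<in> S \<Longrightarrow> \<gamma> \<in> arrows G \<and> rmap G \<gamma> = x \<and> smap G \<gamma> = y"
    "\<And>\<gamma>. \<lbrakk>\<gamma> \<in> arrows G; rmap G \<gamma> = x; smap G \<gamma> = y; f \<gamma> \<noteq> 0\<rbrakk> \<Longrightarrow> \<gamma> \<in> S"
  shows "orbit_sum G f x y = sum f S"
  unfolding orbit_sum_def
proof (rule sum.mono_neutral_left[OF assms(1)])
  show "{\<gamma> \<in> arrows G. rmap G \<gamma> = x \<and> smap G \<gamma> = y \<and> f \<gamma> \<noteq> 0} \<subseteq> S"
    using assms(3) by blast
  show "\<forall>\<gamma> \<in> S - {\<gamma> \<in> arrows G. rmap G \<gamma> = x \<and> smap G \<gamma> = y \<and> f \<gamma> \<noteq> 0}. f \<gamma> = 0"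
    using assms(2) by (metis (mono_tags, lifting) DiffE mem_Collect_eq)
qed

lemma finite_orbit_support:
  assumes "f \<in> steinberg G"
  shows "finite {\<gamma> \<in> arrows G. rmap G \<gamma> = x \<and> smap G \<gamma> = y \<and> f \<gamma> \<noteq> 0}"
  by (rule finite_subset[OF _ finite_fibre(1)[OF assms, of x]]) blast

lemma orbit_sum_add:
  assumes "f \<in> steinberg G" "g \<in> steinberg G"
  shows "orbit_sum G (\<lambda>x. f x + g x) x y = orbit_sum G f x y + orbit_sum G g x y"
proof -
  let ?S = "{\<gamma> \<in> arrows G. rmap G \<gamma> = x \<and> smap G \<gamma> = y \<and> f \<gamma> \<noteq> 0}
    \<union> {\<gamma> \<in> arrows G. rmap G \<gamma> = x \<and> smap G \<gamma> = y \<and> g \<gamma> \<noteq> 0}"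
  have S: "finite ?S" "\<And>\<gamma>. \<gamma> \<in> ?S \<Longrightarrow> \<gamma> \<in> arrows G \<and> rmap G \<gamma> = x \<and> smap G \<gamma> = y"
    using finite_orbit_support[OF assms(1)] finite_orbit_support[OF assms(2)] by auto
  have "orbit_sum G f x y = sum f ?S" "orbit_sum G g x y = sum g ?S"
    by (rule orbit_sum_eq[OF S]; simp)+
  moreover have "orbit_sum G (\<lambda>x. f x + g x) x y = (\<Sum>x\<in>?S. f x + g x)"
  proof (rule orbit_sum_eq[OF S])
    fix \<gamma> assume "\<gamma> \<in> arrows G" "rmap G \<gamma> = x" "smap G \<gamma> = y" "f \<gamma> + g \<gamma> \<noteq> 0"
    then show "\<gamma> \<in> ?S" by (cases "f \<gamma> = 0") simp_all
  qed
  ultimately show ?thesis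
    by (simp add: sum.distrib)
qed

lemma orbit_sum_scale:
  assumes "f \<in> steinberg G"
  shows "orbit_sum G (\<lambda>x. c * f x) x y = c * orbit_sum G f x y"
proof -
  have "orbit_sum G (\<lambda>x. c * f x) x y
      = (\<Sum>\<gamma> | \<gamma> \<in> arrows G \<and> rmap G \<gamma> = x \<and> smap G \<gamma> = y \<and> f \<gamma> \<noteq> 0. c * f \<gamma>)"
  proof (rule orbit_sum_eq[OF finite_orbit_support[OF assms]])
    fix \<gamma> assume "\<gamma> \<in> arrows G" "rmap G \<gamma> = x" "smap G \<gamma> = y" "c * f \<gamma> \<noteq> 0"
    then show "\<gamma> \<in> {\<gamma> \<in> arrows G. rmap G \<gamma> = x \<and> smap G \<gamma> = y \<and> f \<gamma> \<noteq> 0}"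
      by (cases "f \<gamma> = 0") simp_all
  qed simp
  then show ?thesis
    by (simp add: orbit_sum_def sum_distrib_left)
qed

text \<open>Since range is injective on a slice, at most one arrow of it contributes to an entry: up
  to the factor \<open>c\<close> the matrix is a partial permutation matrix.\<close>

lemma orbit_sum_slice:
  assumes B: "slice G B"
  shows "\<lbrakk>b \<in> B; rmap G b = x; smap G b = y\<rbrakk> \<Longrightarrow> orbit_sum G (\<lambda>x. c * indicator B x) x y = c"
    and "(\<And>b. \<lbrakk>b \<in> B; rmap G b = x; smap G b = y\<rbrakk> \<Longrightarrow> False) \<Longrightarrow> orbit_sum G (\<lambda>x. c * indicator B x) x y = 0"
proof -
  assume b: "b \<in> B" "rmap G b = x" "smap G b = y"
  have "orbit_sum G (\<lambda>x. c * indicator B x) x y = (\<Sum>\<gamma>\<in>{b}. c * indicator B \<gamma>)"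
  proof (rule orbit_sum_eq)
    show "\<gamma> \<in> arrows G \<and> rmap G \<gamma> = x \<and> smap G \<gamma> = y" if "\<gamma> \<in> {b}" for \<gamma>
      using that b slice_arrows[OF B] by simp
    fix \<gamma> assume \<gamma>: "\<gamma> \<in> arrows G" "rmap G \<gamma> = x" "smap G \<gamma> = y" "c * indicator B \<gamma> \<noteq> 0"
    then have "\<gamma> \<in> B"
      by (simp add: scaled_indicator_nonzero)
    then have "\<gamma> = b"
      using B b \<gamma>(2) by (metis inj_onD slice_def)
    then show "\<gamma> \<in> {b}" by simp
  qed simp
  then show "orbit_sum G (\<lambda>x. c * indicator B x) x y = c"
    using b by simp
next
  assume none: "\<And>b. \<lbrakk>b \<in> B; rmap G b = x; smap G b = y\<rbrakk> \<Longrightarrow> False"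
  have "orbit_sum G (\<lambda>x. c * indicator B x) x y = (\<Sum>\<gamma>\<in>{}. c * indicator B \<gamma>)"
  proof (rule orbit_sum_eq)
    fix \<gamma> assume \<gamma>: "\<gamma> \<in> arrows G" "rmap G \<gamma> = x" "smap G \<gamma> = y" "c * indicator B \<gamma> \<noteq> 0"
    then show "\<gamma> \<in> {}"
      using none[of \<gamma>] by (simp add: scaled_indicator_nonzero)
  qed simp_all
  then show "orbit_sum G (\<lambda>x. c * indicator B x) x y = 0"
    by simp
qed

text \<open>Left multiplication by \<open>b\<close> is a bijection from the arrows \<open>y\<close>
  \<rightarrow> \<open>smap G b\<close> to the arrows \<open>y\<close> \<rightarrow>
  \<open>rmap G b\<close>. This is matrix multiplication by a partial permutation matrix, which
  moves rows.\<close>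

lemma orbit_sum_slice_left:
  assumes B: "slice G B" and f: "f \<in> steinberg G"
  shows "b \<in> B \<Longrightarrow> orbit_sum G (convolution G (\<lambda>x. c * indicator B x) f) (rmap G b) y
      = c * orbit_sum G f (smap G b) y"
    and "x \<notin> rmap G ` B \<Longrightarrow> orbit_sum G (convolution G (\<lambda>x. c * indicator B x) f) x y = 0"
proof -
  let ?h = "convolution G (\<lambda>x. c * indicator B x) f"
  assume b: "b \<in> B"
  have bG: "b \<in> arrows G"
    using slice_arrows[OF B b] .
  let ?S = "{\<gamma> \<in> arrows G. rmap G \<gamma> = smap G b \<and> smap G \<gamma> = y \<and> f \<gamma> \<noteq> 0}"
  have "orbit_sum G ?h (rmap G b) y = sum ?h (gmult G b ` ?S)"
  proof (rule orbit_sum_eq)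
    show "finite (gmult G b ` ?S)"
      using finite_orbit_support[OF f] by simp
    show "\<gamma> \<in> arrows G \<and> rmap G \<gamma> = rmap G b \<and> smap G \<gamma> = y" if "\<gamma> \<in> gmult G b ` ?S" for \<gamma>
      using that bG by (auto simp: mult_arrow)
    fix \<gamma> assume \<gamma>: "\<gamma> \<in> arrows G" "rmap G \<gamma> = rmap G b" "smap G \<gamma> = y" "?h \<gamma> \<noteq> 0"
    have "?h \<gamma> = c * f (gmult G (ginv G b) \<gamma>)"
      using convolution_slice_left(1)[OF B \<gamma>(1) b] \<gamma>(2) by simp
    then have "f (gmult G (ginv G b) \<gamma>) \<noteq> 0"
      using \<gamma>(4) by auto
    then have "gmult G (ginv G b) \<gamma> \<in> ?S"
      using bG \<gamma> by (simp add: mult_arrow inv_closed s_inv r_inv)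
    moreover have "gmult G b (gmult G (ginv G b) \<gamma>) = \<gamma>"
      using bG \<gamma> by (simp add: mult_inv_cancel)
    ultimately show "\<gamma> \<in> gmult G b ` ?S"
      by (rule image_eqI[OF sym, rotated])
  qed
  also have "\<dots> = (\<Sum>\<gamma>\<in>?S. ?h (gmult G b \<gamma>))"
  proof (subst sum.reindex)
    show "inj_on (gmult G b) ?S"
      by (rule inj_on_inverseI[of _ "gmult G (ginv G b)"]) (use bG in \<open>simp add: inv_mult_cancel\<close>)
  qed simp
  also have "\<dots> = (\<Sum>\<gamma>\<in>?S. c * f \<gamma>)"
  proof (rule sum.cong[OF refl])
    fix \<gamma> assume "\<gamma> \<in> ?S"
    then have \<gamma>: "\<gamma> \<in> arrows G" "smap G b = rmap G \<gamma>" by simp_all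
    show "?h (gmult G b \<gamma>) = c * f \<gamma>"
      using convolution_slice_left(1)[OF B mult_arrow(1)[OF bG \<gamma>] b, of c f] bG \<gamma>
      by (simp add: mult_arrow inv_mult_cancel)
  qed
  finally show "orbit_sum G ?h (rmap G b) y = c * orbit_sum G f (smap G b) y"
    by (simp add: orbit_sum_def sum_distrib_left)
next
  let ?h = "convolution G (\<lambda>x. c * indicator B x) f"
  assume "x \<notin> rmap G ` B"
  then have "?h \<gamma> = 0" if "\<gamma> \<in> arrows G" "rmap G \<gamma> = x" for \<gamma>
    using that convolution_slice_left(2)[OF B that(1)] by simp
  then show "orbit_sum G ?h x y = 0"
    unfolding orbit_sum_def by (intro sum.neutral) blast
qed

lemma orbit_sum_slice_right:
  assumes B: "slice G B" and f: "f \<in> steinberg G"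
  shows "b \<in> B \<Longrightarrow> orbit_sum G (convolution G f (\<lambda>x. c * indicator B x)) x (smap G b)
      = orbit_sum G f x (rmap G b) * c"
    and "y \<notin> smap G ` B \<Longrightarrow> orbit_sum G (convolution G f (\<lambda>x. c * indicator B x)) x y = 0"
proof -
  let ?h = "convolution G f (\<lambda>x. c * indicator B x)"
  assume b: "b \<in> B"
  have bG: "b \<in> arrows G"
    using slice_arrows[OF B b] .
  let ?S = "{\<gamma> \<in> arrows G. rmap G \<gamma> = x \<and> smap G \<gamma> = rmap G b \<and> f \<gamma> \<noteq> 0}"
  let ?m = "\<lambda>\<gamma>. gmult G \<gamma> b"
  have "orbit_sum G ?h x (smap G b) = sum ?h (?m ` ?S)"
  proof (rule orbit_sum_eq)
    show "finite (?m ` ?S)"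
      using finite_orbit_support[OF f] by simp
    show "\<gamma> \<in> arrows G \<and> rmap G \<gamma> = x \<and> smap G \<gamma> = smap G b" if "\<gamma> \<in> ?m ` ?S" for \<gamma>
      using that bG by (auto simp: mult_arrow)
    fix \<gamma> assume \<gamma>: "\<gamma> \<in> arrows G" "rmap G \<gamma> = x" "smap G \<gamma> = smap G b" "?h \<gamma> \<noteq> 0"
    have "?h \<gamma> = f (gmult G \<gamma> (ginv G b)) * c"
      using convolution_slice_right(1)[OF f B \<gamma>(1) b] \<gamma>(3) by simp
    then have "f (gmult G \<gamma> (ginv G b)) \<noteq> 0"
      using \<gamma>(4) by auto
    then have "gmult G \<gamma> (ginv G b) \<in> ?S"
      using bG \<gamma> by (simp add: mult_arrow inv_closed s_inv r_inv)
    moreover have "?m (gmult G \<gamma> (ginv G b)) = \<gamma>"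
      using bG \<gamma> by (simp add: cancel_inv_mult)
    ultimately show "\<gamma> \<in> ?m ` ?S"
      by (rule image_eqI[OF sym, rotated])
  qed
  also have "\<dots> = (\<Sum>\<gamma>\<in>?S. ?h (?m \<gamma>))"
  proof (subst sum.reindex)
    show "inj_on ?m ?S"
      by (rule inj_on_inverseI[of _ "\<lambda>\<gamma>. gmult G \<gamma> (ginv G b)"]) (use bG in \<open>simp add: mult_cancel_inv\<close>)
  qed simp
  also have "\<dots> = (\<Sum>\<gamma>\<in>?S. f \<gamma> * c)"
  proof (rule sum.cong[OF refl])
    fix \<gamma> assume "\<gamma> \<in> ?S"
    then have \<gamma>: "\<gamma> \<in> arrows G" "smap G \<gamma> = rmap G b" by simp_all
    show "?h (?m \<gamma>) = f \<gamma> * c"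
      using convolution_slice_right(1)[OF f B mult_arrow(1)[OF \<gamma>(1) bG \<gamma>(2)] b, of c] bG \<gamma>
      by (simp add: mult_arrow mult_cancel_inv)
  qed
  finally show "orbit_sum G ?h x (smap G b) = orbit_sum G f x (rmap G b) * c"
    by (simp add: orbit_sum_def sum_distrib_right)
next
  let ?h = "convolution G f (\<lambda>x. c * indicator B x)"
  assume "y \<notin> smap G ` B"
  then have "?h \<gamma> = 0" if "\<gamma> \<in> arrows G" "smap G \<gamma> = y" for \<gamma>
    using that convolution_slice_right(2)[OF f B that(1)] by simp
  then show "orbit_sum G ?h x y = 0"
    unfolding orbit_sum_def by (intro sum.neutral) blast
qed

lemma orbit_kernel_add:
  "\<lbrakk>f \<in> orbit_kernel G V; g \<in> orbit_kernel G V\<rbrakk> \<Longrightarrow> (\<lambda>x. f x + g x) \<in> orbit_kernel G V"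
  by (simp add: orbit_kernel_def steinberg_add orbit_sum_add)

lemma orbit_kernel_zero: "(\<lambda>x. 0) \<in> orbit_kernel G V"
  by (simp add: orbit_kernel_def steinberg_zero orbit_sum_def)

text \<open>A slice moves rows or columns along its arrows, and by invariance an arrow with one end
  in \<open>V\<close> has the other there too, so only vanishing entries are moved into
  place.\<close>

lemma orbit_kernel_slice:
  assumes V: "invariant G V" and B: "slice G B" and f: "f \<in> orbit_kernel G V"
  shows "convolution G (\<lambda>x. c * indicator B x) f \<in> orbit_kernel G V"
    and "convolution G f (\<lambda>x. c * indicator B x) \<in> orbit_kernel G V"
proof -
  have fs: "f \<in> steinberg G" and f0: "\<And>x y. \<lbrakk>x \<in> V; y \<in> V\<rbrakk> \<Longrightarrow> orbit_sum G f x y = 0"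
    using f by (simp_all add: orbit_kernel_def)
  have "orbit_sum G (convolution G (\<lambda>x. c * indicator B x) f) x y = 0" if "x \<in> V" "y \<in> V" for x y
  proof (cases "x \<in> rmap G ` B")
    case True
    then obtain b where b: "b \<in> B" "x = rmap G b" by auto
    then have "smap G b \<in> V"
      using invariant_iff[OF V slice_arrows[OF B b(1)]] that by simp
    then show ?thesis
      using orbit_sum_slice_left(1)[OF B fs b(1)] f0 that b(2) by simp
  qed (simp add: orbit_sum_slice_left(2)[OF B fs])
  then show "convolution G (\<lambda>x. c * indicator B x) f \<in> orbit_kernel G V"
    using fs B by (simp add: orbit_kernel_def steinberg_convolution steinberg_slice)
  have "orbit_sum G (convolution G f (\<lambda>x. c * indicator B x)) x y = 0" if "x \<in> V" "y \<in> V" for x y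
  proof (cases "y \<in> smap G ` B")
    case True
    then obtain b where b: "b \<in> B" "y = smap G b" by auto
    then have "rmap G b \<in> V"
      using invariant_iff[OF V slice_arrows[OF B b(1)]] that by simp
    then show ?thesis
      using orbit_sum_slice_right(1)[OF B fs b(1)] f0 that b(2) by simp
  qed (simp add: orbit_sum_slice_right(2)[OF B fs])
  then show "convolution G f (\<lambda>x. c * indicator B x) \<in> orbit_kernel G V"
    using fs B by (simp add: orbit_kernel_def steinberg_convolution steinberg_slice)
qed

text \<open>Slices generate the algebra additively, so induction on the multiplier \<open>a\<close>
  avoids proving that general convolutions correspond to matrix products.\<close>

lemma orbit_kernel_ideal:
  assumes V: "invariant G V"
  shows "steinberg_ideal G (orbit_kernel G V :: ('a \<Rightarrow> 'r::comm_ring_1) set)"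
proof -
  have conv: "convolution G a f \<in> orbit_kernel G V \<and> convolution G f a \<in> orbit_kernel G V"
    if f: "f \<in> orbit_kernel G V" and a: "a \<in> steinberg G" for a f :: "'a \<Rightarrow> 'r"
    using a
  proof (induction rule: steinberg_induct[where Q = "\<lambda>_. True"])
    case zero
    show ?case
      by (simp add: convolution_zero_left convolution_zero_right orbit_kernel_zero)
  next
    case (add a a')
    then show ?case
      by (simp add: convolution_add_left convolution_add_right orbit_kernel_add)
  next
    case (slice c B)
    then show ?case
      using orbit_kernel_slice[OF V slice(1) f] by blast
  qed (use openin_topspace steinberg_supp(5)[OF a] in auto)
  have sub: "orbit_kernel G V \<subseteq> (steinberg G :: ('a \<Rightarrow> 'r) set)"
    by (auto simp: orbit_kernel_def)
  have neg: "(\<lambda>x. - f x) \<in> orbit_kernel G V" if "f \<in> orbit_kernel G V" for f :: "'a \<Rightarrow> 'r"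
    using that steinberg_uminus[of f] orbit_sum_scale[of f "-1"] by (simp add: orbit_kernel_def)
  show ?thesis
    unfolding steinberg_ideal_def
    by (intro conjI ballI sub orbit_kernel_zero orbit_kernel_add neg conv[THEN conjunct1] conv[THEN conjunct2])
qed

text \<open>The matrix is diagonal with entry \<open>c\<close> at the points of \<open>K\<close>.
  The criterion does not mention \<open>c\<close>, and this is what makes the kernel basic.\<close>

lemma scaled_indicator_orbit_kernel:
  assumes K: "compact_open_units G K" and c: "c \<noteq> 0"
  shows "(\<lambda>x. c * indicator K x) \<in> orbit_kernel G V \<longleftrightarrow> K \<inter> V = {}"
proof
  have Ks: "slice G K" and KX: "\<And>x. x \<in> K \<Longrightarrow> x \<in> units G"
    using K compact_open_units_slice compact_open_units_subset by blast+
  show "K \<inter> V = {}" if "(\<lambda>x. c * indicator K x) \<in> orbit_kernel G V"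
  proof (rule ccontr)
    assume "K \<inter> V \<noteq> {}"
    then obtain x where x: "x \<in> K" "x \<in> V" by blast
    have "orbit_sum G (\<lambda>x. c * indicator K x) x x = c"
      using orbit_sum_slice(1)[OF Ks x(1), of x x c] KX[OF x(1)] by (simp add: r_unit s_unit)
    then show False
      using that x c by (simp add: orbit_kernel_def)
  qed
  assume disj: "K \<inter> V = {}"
  have "orbit_sum G (\<lambda>x. c * indicator K x) x y = 0" if "x \<in> V" "y \<in> V" for x y
  proof (rule orbit_sum_slice(2)[OF Ks])
    fix b assume b: "b \<in> K" "rmap G b = x"
    then have "b = x"
      using KX[OF b(1)] by (simp add: r_unit)
    then show False
      using b(1) that(1) disj by blast
  qed
  then show "(\<lambda>x. c * indicator K x) \<in> orbit_kernel G V"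
    using Ks by (simp add: orbit_kernel_def steinberg_slice)
qed

lemma orbit_kernel_basic:
  assumes "invariant G V"
  shows "basic_ideal G (orbit_kernel G V :: ('a \<Rightarrow> 'r::comm_ring_1) set)"
  unfolding basic_ideal_def
proof (intro conjI allI impI orbit_kernel_ideal assms)
  fix K and c :: 'r
  assume *: "compactin (unit_top G) K \<and> openin (unit_top G) K \<and> c \<noteq> 0
    \<and> (\<lambda>x. c * indicator K x) \<in> orbit_kernel G V"
  then have "K \<inter> V = {}"
    using scaled_indicator_orbit_kernel by blast
  then show "(indicator K :: 'a \<Rightarrow> 'r) \<in> orbit_kernel G V"
    using scaled_indicator_orbit_kernel[of K "1::'r" V] * by simp
qed

text \<open>The assumption is applied to \<open>orbit_kernel G V\<close>: once this ideal is known
  to be determined by an open set of units, it cannot contain an element with an arrow over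
  \<open>V\<close> in its support.\<close>

lemma basic_ideals_imp_strongly_effective:
  assumes surj: "\<And>I :: ('a \<Rightarrow> 'r::comm_ring_1) set. basic_ideal G I \<Longrightarrow>
    \<exists>U. openin (unit_top G) U \<and> invariant G U \<and> I = ideal_of G U"
  shows "strongly_effective G"
  unfolding strongly_effective_def
proof (intro allI impI)
  fix V assume "V \<noteq> {} \<and> closedin (unit_top G) V \<and> invariant G V"
  then have V: "invariant G V" by simp
  obtain U where U: "openin (unit_top G) U" "(orbit_kernel G V :: ('a \<Rightarrow> 'r) set) = ideal_of G U"
    using surj[OF orbit_kernel_basic[OF V]] by blast
  have disj: "x \<notin> V" if x: "x \<in> U" for x
  proof -
    obtain K where K: "compact_open_units G K" "x \<in> K" "K \<subseteq> U"
      using U(1) x unit_basis[of U x] by (auto simp: openin_unit_top)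
    have "(\<lambda>x. 1 * indicator K x) \<in> (orbit_kernel G V :: ('a \<Rightarrow> 'r) set)"
      unfolding U(2) using scaled_indicator_ideal_of[OF K(1), of "1::'r"] K(3) by simp
    then show ?thesis
      using scaled_indicator_orbit_kernel[OF K(1), of "1::'r"] K(2) by auto
  qed
  show "effective (reduction G V)"
    unfolding effective_reduction_iff[OF V]
  proof (intro allI impI, rule ccontr)
    fix W x
    assume W: "openin (gtop G) W \<and> x \<in> W \<and> smap G x \<in> V \<and> x \<notin> units G"
      and none: "\<not> (\<exists>y\<in>W. smap G y \<in> V \<and> rmap G y \<noteq> smap G y)"
    have "openin (gtop G) (W - units G)"
      using W closed_units by blast
    then obtain B where B: "slice G B" "x \<in> B" "B \<subseteq> W - units G"
      using slice_basis[of "W - units G" x] W by blast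
    let ?K = "smap G ` B"
    have K: "compact_open_units G ?K"
      using slice_s_image[OF B(1)] by simp
    have Ks: "slice G ?K" and KX: "\<And>x. x \<in> ?K \<Longrightarrow> x \<in> units G"
      using K compact_open_units_slice compact_open_units_subset by blast+
    \<comment> \<open>Every arrow of \<open>B\<close> over \<open>V\<close> is isotropy, so \<open>B\<close> and its source set act alike over \<open>V\<close>.\<close>
    have iso: "rmap G b = smap G b" if "b \<in> B" "smap G b \<in> V" for b
      using that none B(3) by blast
    \<comment> \<open>The factors \<open>1\<close> and \<open>-1\<close> are written out so that the
      lemmas on scaled slices apply.\<close>
    let ?f = "\<lambda>x. 1 * indicator B x + (-1) * indicator ?K x :: 'r"
    have fs: "?f \<in> steinberg G"
      using B(1) Ks by (intro steinberg_add steinberg_slice)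
    have "orbit_sum G ?f y z = 0" if yz: "y \<in> V" "z \<in> V" for y z
    proof -
      have sum: "orbit_sum G ?f y z = orbit_sum G (\<lambda>x. 1 * indicator B x) y z
          + orbit_sum G (\<lambda>x. (-1) * indicator ?K x) y z"
        using B(1) Ks by (intro orbit_sum_add steinberg_slice)
      show ?thesis
      \<comment> \<open>Over \<open>V\<close> both matrices have their nonzero entries exactly on
        the diagonal at the points of \<open>?K\<close>, where they cancel.\<close>
      proof (cases "y = z \<and> y \<in> ?K")
        case True
        then have y: "z = y" "y \<in> ?K" by auto
        then obtain b where b: "b \<in> B" "smap G b = y" by auto
        then have "rmap G b = y"
          using iso yz by simp
        moreover have "rmap G y = y" "smap G y = y"
          using y KX r_unit s_unit by blast+
        ultimately show ?thesis
          using sum orbit_sum_slice(1)[OF B(1) b(1), of y y "1::'r"]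
            orbit_sum_slice(1)[OF Ks, of y y y "-1::'r"] b y by simp
      next
        case False
        have "orbit_sum G (\<lambda>x. 1 * indicator B x :: 'r) y z = 0"
        proof (rule orbit_sum_slice(2)[OF B(1)])
          fix b assume "b \<in> B" "rmap G b = y" "smap G b = z"
          then show False
            using iso yz False by blast
        qed
        moreover have "orbit_sum G (\<lambda>x. (-1) * indicator ?K x :: 'r) y z = 0"
        proof (rule orbit_sum_slice(2)[OF Ks])
          fix b assume "b \<in> ?K" "rmap G b = y" "smap G b = z"
          then show False
            using KX r_unit s_unit False by metis
        qed
        ultimately show ?thesis
          using sum by simp
      qed
    qed
    then have "?f \<in> orbit_kernel G V"
      using fs unfolding orbit_kernel_def by blast
    then have "?f \<in> ideal_of G U"
      using U(2) by simp
    \<comment> \<open>\<open>?K\<close> consists of units and \<open>x\<close> is not one, so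
      \<open>?f x\<close> is the value \<open>1\<close> coming from \<open>B\<close>.\<close>
    moreover have "x \<notin> ?K"
      using KX W by blast
    then have "?f x \<noteq> 0"
      using B(2) by simp
    ultimately have "smap G x \<in> U"
      unfolding ideal_of_iff by blast
    then show False
      using disj W by blast
  qed
qed

text \<open>Forward, \<open>ideal_of_mono_iff\<close> gives injectivity and
  \<open>unit_support\<close> provides preimages; backward, surjectivity feeds
  \<open>basic_ideals_imp_strongly_effective\<close>.\<close>

lemma strongly_effective_iff_lattice_iso:
  "strongly_effective G \<longleftrightarrow>
    lattice_iso_onto_basic_ideals G (ideal_of G :: 'a set \<Rightarrow> ('a \<Rightarrow> 'r::comm_ring_1) set)"
proof
  assume eff: "strongly_effective G"
  have "inj_on (ideal_of G :: 'a set \<Rightarrow> ('a \<Rightarrow> 'r) set) (open_invariant_sets G)"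
  proof (rule inj_onI)
    fix U V assume "U \<in> open_invariant_sets G" "V \<in> open_invariant_sets G"
      and "(ideal_of G U :: ('a \<Rightarrow> 'r) set) = ideal_of G V"
    then show "U = V"
      using ideal_of_mono_iff[where 'r='r]
      by (metis (mono_tags, lifting) mem_Collect_eq open_invariant_sets_def subset_antisym subset_refl)
  qed
  moreover have "ideal_of G ` open_invariant_sets G = {I :: ('a \<Rightarrow> 'r) set. basic_ideal G I}"
  proof
    show "ideal_of G ` open_invariant_sets G \<subseteq> {I :: ('a \<Rightarrow> 'r) set. basic_ideal G I}"
      using ideal_of_basic by (auto simp: open_invariant_sets_def)
    show "{I :: ('a \<Rightarrow> 'r) set. basic_ideal G I} \<subseteq> ideal_of G ` open_invariant_sets G"
    proof
      fix I :: "('a \<Rightarrow> 'r) set" assume "I \<in> {I. basic_ideal G I}"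
      then have I: "basic_ideal G I" "steinberg_ideal G I"
        by (simp_all add: basic_ideal_def)
      have "I = ideal_of G (unit_support G I)"
        using basic_ideal_subset[OF eff I(1)] ideal_of_unit_support_subset[OF I(2)] by blast
      moreover have "unit_support G I \<in> open_invariant_sets G"
        using unit_support_open unit_support_invariant[OF I(2)] by (simp add: open_invariant_sets_def)
      ultimately show "I \<in> ideal_of G ` open_invariant_sets G"
        by (rule image_eqI)
    qed
  qed
  moreover have "ideal_of G (U \<inter> V) = ideal_of G U \<inter> (ideal_of G V :: ('a \<Rightarrow> 'r) set)" for U V
    unfolding ideal_of_def reduction_arrows_def by blast
  ultimately show "lattice_iso_onto_basic_ideals G (ideal_of G :: 'a set \<Rightarrow> ('a \<Rightarrow> 'r) set)"
    unfolding lattice_iso_onto_basic_ideals_def bij_betw_def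
    using ideal_of_Un[where 'r='r] by (auto simp: open_invariant_sets_def)
next
  assume "lattice_iso_onto_basic_ideals G (ideal_of G :: 'a set \<Rightarrow> ('a \<Rightarrow> 'r) set)"
  then have "ideal_of G ` open_invariant_sets G = {I :: ('a \<Rightarrow> 'r) set. basic_ideal G I}"
    by (simp add: lattice_iso_onto_basic_ideals_def bij_betw_def)
  then show "strongly_effective G"
    by (intro basic_ideals_imp_strongly_effective[where 'r='r]) (auto simp: open_invariant_sets_def)
qed

end

theorem theorem3p1:
  fixes G :: "'g tgroupoid"
  assumes "ample_groupoid G" and "Hausdorff_space (gtop G)"
  shows "strongly_effective G \<longleftrightarrow>
    lattice_iso_onto_basic_ideals G (ideal_of G :: 'g set \<Rightarrow> ('g \<Rightarrow> 'r::comm_ring_1) set)"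
proof -
  interpret hausdorff_ample_groupoid G
    using assms by (simp add: hausdorff_ample_groupoid_def hausdorff_ample_groupoid_axioms_def)
  show ?thesis
    by (rule strongly_effective_iff_lattice_iso)
qed

end
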